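(* Let $A\in\{\mathbb{H},\mathbb{O}\}$, let $\Omega=\Omega_D^A$ be a basic domain and let $f\in\mathcal{S}(\Omega)$ be a slice regular function with $N(f)\not\equiv 0$. Then $f$ admits a semi-model, i.e. there exists $\widehat f\in\mathcal{S}(\Omega)$ such that: (1) $N(\widehat f)=N(f)$; (2) the spherical zeros of $\widehat f$ coincide with those of $f$, with the same spherical multiplicities; (3) all isolated nonreal zeros of $\widehat f$ lie in a single slice $\mathbb{C}_I$, for some $I\in\mathbb{S}_A$.
   Context: $A$ is the algebra $\mathbb{H}$ of quaternions or $\mathbb{O}$ of octonions, with standard conjugation $x\mapsto x^c$, $\operatorname{Tr}(x)=x+x^c$, $N(x)=xx^c$. $\mathbb{S}_A=\{I\in A: I^2=-1\}$ and $\mathbb{C}_I=\operatorname{span}_{\mathbb{R}}\{1,I\}$, $\mathbb{C}_I^+=\{x+yI: x\in\mathbb{R},y>0\}$. $A_{\mathbb{C}}=A\otimes_{\mathbb{R}}\mathbb{C}$ is the complexified algebra, with elements $a+\sqrt{-1}\,b$ ($a,b\in A$), complex conjugation $\overline{a+\sqrt{-1}b}=a-\sqrt{-1}b$ and $(a+\sqrt{-1}b)^c=a^c+\sqrt{-1}b^c$. For a nonempty open $D\subset\mathbb{C}$ with $\overline D=D$ (invariant under complex conjugation), its circularization is $\Omega_D^A=\{\alpha+\beta I:\alpha+\sqrt{-1}\beta\in D,\ I\in\mathbb{S}_A\}$. A circular domain is a connected set $\Omega$ of this form; it is a basic domain if for every $J\in\mathbb{S}_A$ the set $\Omega\cap\mathbb{C}_J^+$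 is simply connected. A stem function is a map $F=F_1+\sqrt{-1}F_2:D\to A_{\mathbb{C}}$ ($F_1,F_2$ $A$-valued) with $F(\bar z)=\overline{F(z)}$. It induces the slice function $f=\mathcal{I}(F):\Omega_D^A\to A$, $f(\alpha+I\beta)=F_1(\alpha+\sqrt{-1}\beta)+I\,F_2(\alpha+\sqrt{-1}\beta)$. $f$ is slice regular if $F$ is holomorphic; $\mathcal{S}(\Omega)$ is the set of slice regular functions on $\Omega$. The $*$-product is $\mathcal{I}(F)*\mathcal{I}(G)=\mathcal{I}(FG)$ (pointwise product in $A_{\mathbb{C}}$), $f^c=\mathcal{I}(F^c)$, and $N(f)=f*f^c$. For $q=\alpha+\beta I\in A$, $\mathbb{S}_q=\{\alpha+\beta J: J\in\mathbb{S}_A\}$ and $\Delta_q(x)=x^2-x\operatorname{Tr}(q)+N(q)$. If $f\in\mathcal{S}(\Omega)$ vanishes at a nonreal $q$, its zero set meets $\mathbb{S}_q$ either in $\{q\}$ only ($q$ is then an isolated nonreal zero) or in all of $\mathbb{S}_q$ (then $\mathbb{S}_q$ is a spherical zero). The spherical multiplicity of a spherical zero $\mathbb{S}_q$ is $2m$, where $m$ is the largest integer such that $f=\Delta_q^m*g$ for some $g\in\mathcal{S}(\Omega)$ (where $N(f)\not\equiv0$). *)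

theory Defs
  imports "HOL-Analysis.Analysis"
begin

section \<open>Alternative algebras with conjugation\<close>

class conjugation =
  fixes cjg :: "'a \<Rightarrow> 'a"

text \<open>
  Octonion multiplication is not associative, so the ring and real-algebra classes of the library
  cannot be used. This class states the algebra laws shared by the quaternions and the octonions;
  in particular every square norm and every trace is a real multiple of the unit.
\<close>

class alt_star_algebra = euclidean_space + times + one + conjugation +
  assumes alt_distrib_right: "(x + y) * z = x * z + y * z"
    and alt_distrib_left: "x * (y + z) = x * y + x * z"
    and alt_scaleR_left: "(r *\<^sub>R x) * y = r *\<^sub>R (x * y)"
    and alt_scaleR_right: "x * (r *\<^sub>R y) = r *\<^sub>R (x * y)"
    and alt_one_left: "1 * x = x"
    and alt_one_right: "x * 1 = x"
    and alt_left: "x * (x * y) = (x * x) * y"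
    and alt_right: "(y * x) * x = y * (x * x)"
    and cjg_mult: "cjg (x * y) = cjg y * cjg x"
    and cjg_trace: "x + cjg x = (2 * inner 1 x) *\<^sub>R 1"
    and cjg_norm: "x * cjg x = (norm x)\<^sup>2 *\<^sub>R 1"
    and ex_imag_unit: "\<exists>i. i * i = - 1"

class assoc_star_algebra = alt_star_algebra +
  assumes asa_assoc: "(x * y) * z = x * (y * z)"

class comm_star_algebra = assoc_star_algebra +
  assumes csa_comm: "x * y = y * x"

lemma alt_zero_left:
  fixes x :: "'a::alt_star_algebra"
  shows "0 * x = 0"
  using alt_scaleR_left[of 0 0 x] by simp

lemma alt_zero_right:
  fixes x :: "'a::alt_star_algebra"
  shows "x * 0 = 0"
  using alt_scaleR_right[of x 0 0] by simp

lemma alt_minus_left: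
  fixes x y :: "'a::alt_star_algebra"
  shows "(- x) * y = - (x * y)"
  using alt_scaleR_left[of "-1" x y] by simp

lemma alt_minus_right:
  fixes x y :: "'a::alt_star_algebra"
  shows "x * (- y) = - (x * y)"
  using alt_scaleR_right[of x "-1" y] by simp

lemma alt_diff_left:
  fixes x y z :: "'a::alt_star_algebra"
  shows "(x - y) * z = x * z - y * z"
  using alt_distrib_right[of x "- y" z] by (simp add: alt_minus_left)

lemma alt_diff_right:
  fixes x y z :: "'a::alt_star_algebra"
  shows "z * (x - y) = z * x - z * y"
  using alt_distrib_left[of z x "- y"] by (simp add: alt_minus_right)

lemmas alt_bilinear = alt_distrib_right alt_distrib_left alt_scaleR_left alt_scaleR_right
  alt_one_left alt_one_right alt_zero_left alt_zero_right alt_minus_left alt_minus_right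
  alt_diff_left alt_diff_right

lemma alt_one_neq_zero: "1 \<noteq> (0::'a::alt_star_algebra)"
proof
  assume "1 = (0::'a)"
  then have "x = 0" for x :: 'a
    using alt_one_left[of x] by (simp add: alt_zero_left)
  then show False
    using nonempty_Basis nonzero_Basis by blast
qed

lemma cjg_eq:
  fixes x :: "'a::alt_star_algebra"
  shows "cjg x = (2 * inner 1 x) *\<^sub>R 1 - x"
  using cjg_trace[of x] by (metis add_diff_cancel_left')

lemma norm_one_alt: "norm (1::'a::alt_star_algebra) = 1"
proof -
  have n1: "cjg 1 = (norm (1::'a))\<^sup>2 *\<^sub>R (1::'a)"
    using cjg_norm[of "1::'a"] by (simp add: alt_one_left)
  have n2: "cjg 1 = (2 * (norm (1::'a))\<^sup>2 - 1) *\<^sub>R (1::'a)"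
    by (simp add: cjg_eq scaleR_left_diff_distrib power2_norm_eq_inner)
  have "(norm (1::'a))\<^sup>2 *\<^sub>R (1::'a) = (2 * (norm (1::'a))\<^sup>2 - 1) *\<^sub>R 1"
    by (rule trans[OF n1[symmetric] n2])
  then have "(norm (1::'a))\<^sup>2 = 1"
    using alt_one_neq_zero[where 'a='a] unfolding scaleR_cancel_right by linarith
  then show ?thesis
    using norm_ge_zero[of "1::'a"] unfolding power2_eq_1_iff by linarith
qed

lemma inner_one_one: "inner 1 (1::'a::alt_star_algebra) = 1"
  using norm_one_alt by (simp add: norm_eq_1)

lemma cjg_add:
  fixes x y :: "'a::alt_star_algebra"
  shows "cjg (x + y) = cjg x + cjg y"
  by (simp add: cjg_eq inner_add_right algebra_simps scaleR_left_distrib)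

lemma cjg_scaleR:
  fixes x :: "'a::alt_star_algebra"
  shows "cjg (r *\<^sub>R x) = r *\<^sub>R cjg x"
  by (simp add: cjg_eq scaleR_right_diff_distrib mult_ac)

lemma cjg_minus:
  fixes x :: "'a::alt_star_algebra"
  shows "cjg (- x) = - cjg x"
  using cjg_scaleR[of "-1" x] by simp

lemma cjg_diff:
  fixes x y :: "'a::alt_star_algebra"
  shows "cjg (x - y) = cjg x - cjg y"
  using cjg_add[of x "- y"] by (simp add: cjg_minus)

lemma cjg_cjg:
  fixes x :: "'a::alt_star_algebra"
  shows "cjg (cjg x) = x"
  by (simp add: cjg_eq inner_diff_right inner_one_one algebra_simps)

lemma cjg_one: "cjg 1 = (1::'a::alt_star_algebra)"
  using cjg_norm[of "1::'a"] by (simp add: alt_one_left norm_one_alt)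

lemma inner_one_cjg:
  fixes x :: "'a::alt_star_algebra"
  shows "inner 1 (cjg x) = inner 1 x"
  by (simp add: cjg_eq inner_diff_right inner_one_one)

lemma norm_cjg:
  fixes x :: "'a::alt_star_algebra"
  shows "norm (cjg x) = norm x"
proof -
  have "inner (cjg x) (cjg x) = inner x x"
    by (simp add: cjg_eq inner_diff_right inner_diff_left inner_one_one inner_commute algebra_simps)
  then show ?thesis by (simp add: norm_eq_sqrt_inner)
qed

lemma cjg_norm':
  fixes x :: "'a::alt_star_algebra"
  shows "cjg x * x = (norm x)\<^sup>2 *\<^sub>R 1"
  using cjg_norm[of "cjg x"] by (simp add: cjg_cjg norm_cjg)

lemma cjg_cancel_left:
  fixes x y :: "'a::alt_star_algebra"
  shows "cjg x * (x * y) = (norm x)\<^sup>2 *\<^sub>R y"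
proof -
  have "cjg x * (x * y) = (cjg x * x) * y"
    by (simp add: cjg_eq alt_bilinear alt_left)
  then show ?thesis by (simp add: cjg_norm' alt_bilinear)
qed

lemma cjg_cancel_left':
  fixes x y :: "'a::alt_star_algebra"
  shows "x * (cjg x * y) = (norm x)\<^sup>2 *\<^sub>R y"
  using cjg_cancel_left[of "cjg x" y] by (simp add: cjg_cjg norm_cjg)

instantiation complex :: comm_star_algebra
begin

definition cjg_complex :: "complex \<Rightarrow> complex" where
  "cjg_complex = cnj"

instance
proof
  show "\<exists>i::complex. i * i = - 1"
    using i_squared by blast
  show "x * cjg x = (norm x)\<^sup>2 *\<^sub>R 1" for x :: complex
    unfolding cjg_complex_def by (simp only: complex_norm_square [symmetric]) (simp add: scaleR_conv_of_real)
qed (auto simp: cjg_complex_def complex_eq_iff algebra_simps inner_complex_def)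

end

section \<open>Quaternions and octonions\<close>

text \<open>
  The Cayley--Dickson double of an algebra. The quaternions are the double of the complex numbers
  and the octonions are the double of the quaternions; the Euclidean structure is that of the
  product space.
\<close>

typedef 'a cd_double = "UNIV :: ('a \<times> 'a) set"
  morphisms cd_pair CD ..

setup_lifting type_definition_cd_double

instantiation cd_double :: (euclidean_space) real_vector
begin

lift_definition zero_cd_double :: "'a cd_double" is 0 .
lift_definition plus_cd_double :: "'a cd_double \<Rightarrow> 'a cd_double \<Rightarrow> 'a cd_double" is "(+)" .
lift_definition minus_cd_double :: "'a cd_double \<Rightarrow> 'a cd_double \<Rightarrow> 'a cd_double" is "(-)" .
lift_definition uminus_cd_double :: "'a cd_double \<Rightarrow> 'a cd_double" is uminus .
lift_definition scaleR_cd_double :: "real \<Rightarrow> 'a cd_double \<Rightarrow> 'a cd_double" is "(*\<^sub>R)" .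

instance
proof
  fix x y z :: "'a cd_double" and a b :: real
  show "x + y + z = x + (y + z)" "x + y = y + x" "0 + x = x" "- x + x = 0" "x - y = x + - y"
    by (transfer; simp)+
  show "a *\<^sub>R (x + y) = a *\<^sub>R x + a *\<^sub>R y" "(a + b) *\<^sub>R x = a *\<^sub>R x + b *\<^sub>R x"
    "a *\<^sub>R b *\<^sub>R x = (a * b) *\<^sub>R x" "1 *\<^sub>R x = x"
    by (transfer; simp add: scaleR_add_right scaleR_add_left)+
qed

end

instantiation cd_double :: (euclidean_space) euclidean_space
begin

lift_definition inner_cd_double :: "'a cd_double \<Rightarrow> 'a cd_double \<Rightarrow> real" is inner .
lift_definition norm_cd_double :: "'a cd_double \<Rightarrow> real" is norm .
lift_definition Basis_cd_double :: "'a cd_double set" is Basis .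

definition sgn_cd_double :: "'a cd_double \<Rightarrow> 'a cd_double" where
  "sgn_cd_double x = x /\<^sub>R norm x"
definition dist_cd_double :: "'a cd_double \<Rightarrow> 'a cd_double \<Rightarrow> real" where
  "dist_cd_double x y = norm (x - y)"
definition uniformity_cd_double :: "('a cd_double \<times> 'a cd_double) filter" where
  "uniformity_cd_double = (INF e\<in>{0<..}. principal {(x, y). dist x y < e})"
definition open_cd_double :: "'a cd_double set \<Rightarrow> bool" where
  "open_cd_double U \<longleftrightarrow> (\<forall>x\<in>U. eventually (\<lambda>(x', y). x' = x \<longrightarrow> y \<in> U) uniformity)"

instance
proof
  fix x y z :: "'a cd_double" and a :: real and U :: "'a cd_double set"
  show "sgn x = x /\<^sub>R norm x" by (rule sgn_cd_double_def)
  show "dist x y = norm (x - y)" by (rule dist_cd_double_def)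
  show "uniformity = (INF e\<in>{0<..}. principal {(x, y :: 'a cd_double). dist x y < e})"
    by (rule uniformity_cd_double_def)
  show "open U \<longleftrightarrow> (\<forall>x\<in>U. eventually (\<lambda>(x', y). x' = x \<longrightarrow> y \<in> U) uniformity)"
    by (rule open_cd_double_def)
  show "inner x y = inner y x" by (transfer, rule inner_commute)
  show "inner (x + y) z = inner x z + inner y z" by (transfer, rule inner_add_left)
  show "inner (a *\<^sub>R x) y = a * inner x y" by (transfer, rule inner_scaleR_left)
  show "0 \<le> inner x x" by (transfer, rule inner_ge_zero)
  show "inner x x = 0 \<longleftrightarrow> x = 0" by (transfer, rule inner_eq_zero_iff)
  show "norm x = sqrt (inner x x)" by (transfer, rule norm_eq_sqrt_inner)
  show "(Basis :: 'a cd_double set) \<noteq> {}" by (transfer, rule nonempty_Basis)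
  show "finite (Basis :: 'a cd_double set)" by (transfer, rule finite_Basis)
  show "(\<forall>u\<in>Basis. inner x u = 0) \<longleftrightarrow> x = 0" by (transfer, rule euclidean_all_zero_iff)
next
  show "u \<in> Basis \<Longrightarrow> v \<in> Basis \<Longrightarrow> inner u v = (if u = v then 1 else 0)" for u v :: "'a cd_double"
    by (transfer, rule inner_Basis)
qed

end

instantiation cd_double :: (alt_star_algebra) "{times, one, conjugation}"
begin

lift_definition times_cd_double :: "'a cd_double \<Rightarrow> 'a cd_double \<Rightarrow> 'a cd_double"
  is "\<lambda>(a, b) (c, d). (a * c - cjg d * b, d * a + b * cjg c)" .
lift_definition one_cd_double :: "'a cd_double" is "(1, 0)" .
lift_definition cjg_cd_double :: "'a cd_double \<Rightarrow> 'a cd_double" is "\<lambda>(a, b). (cjg a, - b)" .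

instance ..

end

instance cd_double :: (assoc_star_algebra) alt_star_algebra
proof
  fix x y z :: "'a cd_double" and r :: real
  note bil = alt_bilinear cjg_add cjg_scaleR cjg_minus cjg_diff cjg_cjg cjg_mult
  show "(x + y) * z = x * z + y * z" "x * (y + z) = x * y + x * z"
    "(r *\<^sub>R x) * y = r *\<^sub>R (x * y)" "x * (r *\<^sub>R y) = r *\<^sub>R (x * y)"
    "cjg (x * y) = cjg y * cjg x"
    by (transfer; auto simp: bil algebra_simps)+
  have zero: "cjg (0::'a) = 0"
    using cjg_scaleR[of 0 "0::'a"] by simp
  show "1 * x = x" "x * 1 = x"
    by (transfer; auto simp: bil zero cjg_one)+
  show trace: "x + cjg x = (2 * inner 1 x) *\<^sub>R 1" for x :: "'a cd_double"
    by (transfer; auto simp: cjg_trace)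
  show "x * cjg x = (norm x)\<^sup>2 *\<^sub>R 1"
    by transfer (auto simp: bil cjg_norm cjg_norm' norm_Pair scaleR_add_left)
  obtain i :: 'a where "i * i = - 1" using ex_imag_unit by blast
  then show "\<exists>i::'a cd_double. i * i = - 1"
    by (intro exI[of _ "CD (i, 0)"]) (transfer, auto simp: bil zero)
  have cjg_eq': "cjg x = (2 * inner 1 x) *\<^sub>R 1 - x" for x :: "'a cd_double"
    using trace[of x] by (metis add_diff_cancel_left')
  note nrm = cjg_norm cjg_norm' cjg_cancel_left cjg_cancel_left'
  have left: "cjg x * (x * y) = (cjg x * x) * y" for x y :: "'a cd_double"
    by (transfer; auto simp: bil asa_assoc nrm)
  have right: "(y * x) * cjg x = y * (x * cjg x)" for x y :: "'a cd_double"
    by (transfer; auto simp: bil asa_assoc nrm zero cjg_one scaleR_add_left add.commute)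
  have dist: "(x - y) * z = x * z - y * z" "z * (x - y) = z * x - z * y" for x y z :: "'a cd_double"
    by (transfer; auto simp: bil algebra_simps)+
  have scale: "(r *\<^sub>R x) * y = r *\<^sub>R (x * y)" "x * (r *\<^sub>R y) = r *\<^sub>R (x * y)"
    for x y :: "'a cd_double" and r :: real
    by (transfer; auto simp: bil algebra_simps)+
  have unit: "1 * x = x" "x * 1 = x" for x :: "'a cd_double"
    by (transfer; auto simp: bil zero cjg_one)+
  show "x * (x * y) = (x * x) * y"
    using left[of x y] by (simp add: cjg_eq' dist scale unit)
  show "(y * x) * x = y * (x * x)"
    using right[of y x] by (simp add: cjg_eq' dist scale unit)
qed

instance cd_double :: (comm_star_algebra) assoc_star_algebra
proof
  fix x y z :: "'a cd_double"
  note bil = alt_bilinear cjg_add cjg_scaleR cjg_minus cjg_diff cjg_cjg cjg_mult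
  have lcomm: "a * (b * c) = b * (a * c)" for a b c :: 'a
    by (metis asa_assoc csa_comm)
  show "(x * y) * z = x * (y * z)"
    by (transfer; auto simp: bil asa_assoc csa_comm lcomm)
qed

type_synonym quaternion = "complex cd_double"
type_synonym octonion = "quaternion cd_double"

section \<open>Circular domains\<close>

definition imag_units :: "'a::alt_star_algebra set" where
  "imag_units = {I. I * I = - 1}"

definition slice_point :: "complex \<Rightarrow> 'a::alt_star_algebra \<Rightarrow> 'a" where
  "slice_point z I = Re z *\<^sub>R 1 + Im z *\<^sub>R I"

definition slice :: "'a::alt_star_algebra \<Rightarrow> 'a set" where
  "slice I = span {1, I}"

definition upper_half_slice :: "'a::alt_star_algebra \<Rightarrow> 'a set" where
  "upper_half_slice I = {slice_point z I | z. Im z > 0}"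

definition circularization :: "complex set \<Rightarrow> 'a::alt_star_algebra set" where
  "circularization D = {slice_point z I | z I. z \<in> D \<and> I \<in> imag_units}"

definition circular_domain :: "complex set \<Rightarrow> 'a::alt_star_algebra set \<Rightarrow> bool" where
  "circular_domain D \<Omega> \<longleftrightarrow>
     D \<noteq> {} \<and> open D \<and> cnj ` D = D \<and> \<Omega> = circularization D \<and> connected \<Omega>"

definition basic_domain :: "complex set \<Rightarrow> 'a::alt_star_algebra set \<Rightarrow> bool" where
  "basic_domain D \<Omega> \<longleftrightarrow> circular_domain D \<Omega> \<and>
     (\<forall>J\<in>imag_units. simply_connected (\<Omega> \<inter> upper_half_slice J))"

section \<open>Stem functions and slice functions\<close>

text \<open>A pair \<open>(a, b)\<close> represents the element \<open>a + \<surd>-1 b\<close> of the complexified algebra.\<close>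

type_synonym 'a complexified = "'a \<times> 'a"

definition cx_mult :: "'a::alt_star_algebra complexified \<Rightarrow> 'a complexified \<Rightarrow> 'a complexified" where
  "cx_mult = (\<lambda>(a, b) (c, d). (a * c - b * d, a * d + b * c))"

definition cx_bar :: "'a::alt_star_algebra complexified \<Rightarrow> 'a complexified" where
  "cx_bar = (\<lambda>(a, b). (a, - b))"

definition cx_cjg :: "'a::alt_star_algebra complexified \<Rightarrow> 'a complexified" where
  "cx_cjg = (\<lambda>(a, b). (cjg a, cjg b))"

definition cx_scale :: "complex \<Rightarrow> 'a::alt_star_algebra complexified \<Rightarrow> 'a complexified" where
  "cx_scale w = (\<lambda>(a, b). (Re w *\<^sub>R a - Im w *\<^sub>R b, Re w *\<^sub>R b + Im w *\<^sub>R a))"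

definition stem_function :: "complex set \<Rightarrow> (complex \<Rightarrow> 'a::alt_star_algebra complexified) \<Rightarrow> bool" where
  "stem_function D F \<longleftrightarrow> (\<forall>z\<in>D. F (cnj z) = cx_bar (F z))"

text \<open>Complex differentiability with respect to multiplication by \<open>\<surd>-1\<close> on the target.\<close>

definition stem_holomorphic :: "complex set \<Rightarrow> (complex \<Rightarrow> 'a::alt_star_algebra complexified) \<Rightarrow> bool" where
  "stem_holomorphic D F \<longleftrightarrow> (\<forall>z\<in>D. \<exists>F'. (F has_derivative (\<lambda>h. cx_scale h F')) (at z))"

text \<open>
  A point has several representations \<open>\<alpha> + \<beta> I\<close>; by \<open>slice_fun_slice_point\<close> below the value
  does not depend on the choice when \<open>F\<close> is a stem function. Functions on a circular domain are
  total functions whose values outside the domain are irrelevant.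
\<close>

definition slice_fun :: "complex set \<Rightarrow> (complex \<Rightarrow> 'a::alt_star_algebra complexified) \<Rightarrow> 'a \<Rightarrow> 'a" where
  "slice_fun D F x =
     (THE y. \<exists>z\<in>D. \<exists>I\<in>imag_units. x = slice_point z I \<and> y = fst (F z) + I * snd (F z))"

definition slice_regular :: "complex set \<Rightarrow> ('a::alt_star_algebra \<Rightarrow> 'a) \<Rightarrow> bool" where
  "slice_regular D f \<longleftrightarrow>
     (\<exists>F. stem_function D F \<and> stem_holomorphic D F \<and> (\<forall>x\<in>circularization D. f x = slice_fun D F x))"

text \<open>
  The stem function of a slice function; the clause outside \<open>D\<close> makes it unique
  (see \<open>stem_of_slice_fun\<close> below).
\<close>

definition stem_of :: "complex set \<Rightarrow> ('a::alt_star_algebra \<Rightarrow> 'a) \<Rightarrow> complex \<Rightarrow> 'a complexified" where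
  "stem_of D f =
     (THE F. stem_function D F \<and> (\<forall>x\<in>circularization D. f x = slice_fun D F x) \<and>
        (\<forall>z. z \<notin> D \<longrightarrow> F z = 0))"

definition star_prod ::
    "complex set \<Rightarrow> ('a::alt_star_algebra \<Rightarrow> 'a) \<Rightarrow> ('a \<Rightarrow> 'a) \<Rightarrow> 'a \<Rightarrow> 'a" where
  "star_prod D f g = slice_fun D (\<lambda>z. cx_mult (stem_of D f z) (stem_of D g z))"

text \<open>
  In the non-associative case the power is bracketed to the right; it is only used below for the
  slice functions \<open>\<Delta>\<^sub>q\<close>, whose stem functions have real components.
\<close>

primrec star_power ::
    "complex set \<Rightarrow> ('a::alt_star_algebra \<Rightarrow> 'a) \<Rightarrow> nat \<Rightarrow> 'a \<Rightarrow> 'a" where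
  "star_power D f 0 = (\<lambda>x. 1)"
| "star_power D f (Suc n) = star_prod D f (star_power D f n)"

definition slice_cjg :: "complex set \<Rightarrow> ('a::alt_star_algebra \<Rightarrow> 'a) \<Rightarrow> 'a \<Rightarrow> 'a" where
  "slice_cjg D f = slice_fun D (\<lambda>z. cx_cjg (stem_of D f z))"

definition normal_fun :: "complex set \<Rightarrow> ('a::alt_star_algebra \<Rightarrow> 'a) \<Rightarrow> 'a \<Rightarrow> 'a" where
  "normal_fun D f = star_prod D f (slice_cjg D f)"

section \<open>Zeros of slice functions\<close>

definition nonreal :: "'a::alt_star_algebra \<Rightarrow> bool" where
  "nonreal x \<longleftrightarrow> x \<notin> range (\<lambda>r. r *\<^sub>R 1)"

definition sphere_of :: "'a::alt_star_algebra \<Rightarrow> 'a set" where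
  "sphere_of q = {slice_point z J | z J. J \<in> imag_units \<and> (\<exists>I\<in>imag_units. q = slice_point z I)}"

definition char_poly_of :: "'a::alt_star_algebra \<Rightarrow> 'a \<Rightarrow> 'a" where
  "char_poly_of q x = x * x - x * (q + cjg q) + q * cjg q"

definition isolated_nonreal_zero :: "complex set \<Rightarrow> ('a::alt_star_algebra \<Rightarrow> 'a) \<Rightarrow> 'a \<Rightarrow> bool" where
  "isolated_nonreal_zero D f q \<longleftrightarrow>
     q \<in> circularization D \<and> nonreal q \<and> {x \<in> sphere_of q. f x = 0} = {q}"

definition spherical_zeros :: "complex set \<Rightarrow> ('a::alt_star_algebra \<Rightarrow> 'a) \<Rightarrow> 'a set set" where
  "spherical_zeros D f =
     {sphere_of q | q. q \<in> circularization D \<and> nonreal q \<and> (\<forall>x\<in>sphere_of q. f x = 0)}"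

text \<open>\<open>\<Delta>\<^sub>q\<close>, and hence the spherical multiplicity, depends only on the sphere of \<open>q\<close>.\<close>

definition spherical_multiplicity :: "complex set \<Rightarrow> ('a::alt_star_algebra \<Rightarrow> 'a) \<Rightarrow> 'a \<Rightarrow> nat" where
  "spherical_multiplicity D f q =
     2 * (GREATEST m. \<exists>g. slice_regular D g \<and>
            (\<forall>x\<in>circularization D. f x = star_prod D (star_power D (char_poly_of q) m) g x))"

definition semi_model :: "complex set \<Rightarrow> ('a::alt_star_algebra \<Rightarrow> 'a) \<Rightarrow> ('a \<Rightarrow> 'a) \<Rightarrow> bool" where
  "semi_model D f g \<longleftrightarrow>
     slice_regular D g \<and>
     (\<forall>x\<in>circularization D. normal_fun D g x = normal_fun D f x) \<and>
     spherical_zeros D g = spherical_zeros D f \<and>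
     (\<forall>q. sphere_of q \<in> spherical_zeros D f \<longrightarrow>
        spherical_multiplicity D g q = spherical_multiplicity D f q) \<and>
     (\<exists>I\<in>imag_units. \<forall>q. isolated_nonreal_zero D g q \<longrightarrow> q \<in> slice I)"

section \<open>Well-definedness\<close>

lemma imag_unitD:
  fixes I :: "'a::alt_star_algebra"
  assumes "I \<in> imag_units"
  shows "inner 1 I = 0" "norm I = 1" "cjg I = - I"
proof -
  have sq: "I * I = - 1" using assms by (simp add: imag_units_def)
  define t where "t = 2 * inner 1 I"
  have "I * cjg I = t *\<^sub>R I - I * I"
    by (simp add: cjg_eq alt_bilinear t_def)
  then have eq: "t *\<^sub>R I = ((norm I)\<^sup>2 - 1) *\<^sub>R 1"
    by (simp add: sq cjg_norm algebra_simps)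
  have t: "t = 0"
  proof (rule ccontr)
    assume "t \<noteq> 0"
    define r where "r = ((norm I)\<^sup>2 - 1) / t"
    have "I = (1 / t) *\<^sub>R (t *\<^sub>R I)" using \<open>t \<noteq> 0\<close> by simp
    then have I: "I = r *\<^sub>R 1" unfolding eq r_def by simp
    have "(r * r) *\<^sub>R (1::'a) = (- 1) *\<^sub>R 1"
      using sq unfolding I by (simp add: alt_bilinear)
    then have "r * r = - 1"
      using alt_one_neq_zero[where 'a='a] unfolding scaleR_cancel_right by simp
    then show False using zero_le_square[of r] by linarith
  qed
  then show *: "inner 1 I = 0" by (simp add: t_def)
  have "(norm I)\<^sup>2 - 1 = 0"
    using eq t alt_one_neq_zero[where 'a='a] by auto
  then have "(norm I)\<^sup>2 = 1" by simp
  then show "norm I = 1"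
    using norm_ge_zero[of I] unfolding power2_eq_1_iff by linarith
  show "cjg I = - I" by (simp add: cjg_eq *)
qed

lemma imag_units_minus: "- I \<in> imag_units \<longleftrightarrow> (I::'a::alt_star_algebra) \<in> imag_units"
  by (simp add: imag_units_def alt_bilinear)

lemma slice_point_eq:
  fixes I J :: "'a::alt_star_algebra"
  assumes "I \<in> imag_units" "J \<in> imag_units" "slice_point z I = slice_point w J"
  shows "w = z \<and> (Im z = 0 \<or> J = I) \<or> w = cnj z \<and> J = - I"
proof -
  note I = imag_unitD[OF assms(1)] and J = imag_unitD[OF assms(2)]
  have re: "Re z = Re w"
    using arg_cong[OF assms(3), of "inner 1"]
    by (simp add: slice_point_def inner_add_right inner_one_one I J)
  with assms(3) have im: "Im z *\<^sub>R I = Im w *\<^sub>R J"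
    by (simp add: slice_point_def)
  have "\<bar>Im z\<bar> = \<bar>Im w\<bar>"
    using arg_cong[OF im, of norm] by (simp add: I J)
  then consider "Im w = Im z" | "Im w = - Im z" "Im z \<noteq> 0" by linarith
  then show ?thesis
  proof cases
    case 1
    then show ?thesis using re im by (auto simp: complex_eq_iff)
  next
    case 2
    then have "Im z *\<^sub>R I = Im z *\<^sub>R (- J)" using im by simp
    then have "I = - J" using 2(2) unfolding scaleR_cancel_left by simp
    then show ?thesis using re 2 by (simp add: complex_eq_iff)
  qed
qed

lemma eq_uminus_imp_zero: "(x::'a::real_vector) = - x \<Longrightarrow> x = 0"
  unfolding eq_neg_iff_add_eq_0 scaleR_2[symmetric] by simp

lemma slice_fun_slice_point:
  fixes I :: "'a::alt_star_algebra"
  assumes "stem_function D F" "z \<in> D" "I \<in> imag_units"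
  shows "slice_fun D F (slice_point z I) = fst (F z) + I * snd (F z)"
  unfolding slice_fun_def
proof (rule the_equality)
  show "\<exists>w\<in>D. \<exists>J\<in>imag_units. slice_point z I = slice_point w J \<and>
          fst (F z) + I * snd (F z) = fst (F w) + J * snd (F w)"
    using assms by blast
next
  fix y
  assume "\<exists>w\<in>D. \<exists>J\<in>imag_units. slice_point z I = slice_point w J \<and> y = fst (F w) + J * snd (F w)"
  then obtain w J where w: "w \<in> D" "J \<in> imag_units" "slice_point z I = slice_point w J"
    and y: "y = fst (F w) + J * snd (F w)" by blast
  have bar: "F (cnj z) = cx_bar (F z)" using assms by (simp add: stem_function_def)
  from slice_point_eq[OF assms(3) w(2,3)]
  consider "w = z" "Im z = 0" | "w = z" "J = I" | "w = cnj z" "J = - I" by blast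
  then show "y = fst (F z) + I * snd (F z)"
  proof cases
    case 1
    then have "cnj z = z" by (simp add: complex_eq_iff)
    with bar have "snd (F z) = - snd (F z)"
      by (metis cx_bar_def case_prod_unfold snd_conv)
    then have "snd (F z) = 0" by (rule eq_uminus_imp_zero)
    with 1 y show ?thesis by (simp add: alt_bilinear)
  next
    case 2
    with y show ?thesis by simp
  next
    case 3
    with y bar show ?thesis by (simp add: cx_bar_def case_prod_unfold alt_bilinear)
  qed
qed

lemma slice_fun_cong:
  assumes "\<And>z. z \<in> D \<Longrightarrow> F z = G z"
  shows "slice_fun D F = slice_fun D G"
  unfolding slice_fun_def using assms by (simp cong: bex_cong)

lemma stem_unique:
  fixes F G :: "complex \<Rightarrow> 'a::alt_star_algebra complexified"
  assumes F: "stem_function D F" and G: "stem_function D G" and "z \<in> D"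
    and eq: "\<forall>x\<in>circularization D. slice_fun D F x = slice_fun D G x"
  shows "F z = G z"
proof -
  obtain I :: 'a where "I * I = - 1" using ex_imag_unit by blast
  then have I: "I \<in> imag_units" by (simp add: imag_units_def)
  have *: "fst (F z) + J * snd (F z) = fst (G z) + J * snd (G z)" if J: "J \<in> imag_units" for J
  proof -
    have "slice_point z J \<in> circularization D"
      using \<open>z \<in> D\<close> J by (auto simp: circularization_def)
    with eq show ?thesis
      using slice_fun_slice_point[OF F \<open>z \<in> D\<close> J] slice_fun_slice_point[OF G \<open>z \<in> D\<close> J] by simp
  qed
  have p: "fst (F z) - fst (G z) = I * (snd (G z) - snd (F z))"
    using *[OF I] by (simp add: alt_bilinear algebra_simps)
  have m: "fst (F z) - fst (G z) = - (I * (snd (G z) - snd (F z)))"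
    using *[of "- I"] I by (simp add: imag_units_minus alt_bilinear algebra_simps)
  have z: "I * (snd (G z) - snd (F z)) = 0"
    using m unfolding p by (rule eq_uminus_imp_zero)
  have "I * (I * (snd (G z) - snd (F z))) = - (snd (G z) - snd (F z))"
    using \<open>I * I = - 1\<close> by (simp add: alt_left alt_bilinear)
  with z have "snd (G z) = snd (F z)" by (simp add: alt_zero_right)
  moreover have "fst (F z) = fst (G z)" using p z by simp
  ultimately show ?thesis by (simp add: prod_eq_iff)
qed

lemma stem_of_slice_fun:
  fixes F :: "complex \<Rightarrow> 'a::alt_star_algebra complexified"
  assumes D: "cnj ` D = D" and F: "stem_function D F"
    and f: "\<forall>x\<in>circularization D. f x = slice_fun D F x"
  shows "stem_of D f = (\<lambda>z. if z \<in> D then F z else 0)"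
  unfolding stem_of_def
proof (rule the_equality)
  let ?G = "\<lambda>z. if z \<in> D then F z else 0"
  have G: "stem_function D ?G"
    using F D by (force simp: stem_function_def)
  have "f x = slice_fun D ?G x" if x: "x \<in> circularization D" for x
  proof -
    obtain z I where z: "z \<in> D" "I \<in> imag_units" "x = slice_point z I"
      using x by (auto simp: circularization_def)
    then show ?thesis
      using f x slice_fun_slice_point[OF F z(1,2)] slice_fun_slice_point[OF G z(1,2)] by simp
  qed
  with G show "stem_function D ?G \<and> (\<forall>x\<in>circularization D. f x = slice_fun D ?G x) \<and>
      (\<forall>z. z \<notin> D \<longrightarrow> ?G z = 0)" by simp
next
  fix H
  assume H: "stem_function D H \<and> (\<forall>x\<in>circularization D. f x = slice_fun D H x) \<and>
      (\<forall>z. z \<notin> D \<longrightarrow> H z = 0)"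
  have "H z = F z" if "z \<in> D" for z
    using stem_unique[of D H F z] H F f that by auto
  with H show "H = (\<lambda>z. if z \<in> D then F z else 0)" by auto
qed

lemma star_prod_slice_fun:
  fixes F G :: "complex \<Rightarrow> 'a::alt_star_algebra complexified"
  assumes D: "cnj ` D = D" and F: "stem_function D F" and G: "stem_function D G"
  shows "star_prod D (slice_fun D F) (slice_fun D G) = slice_fun D (\<lambda>z. cx_mult (F z) (G z))"
proof -
  have "stem_of D (slice_fun D F) = (\<lambda>z. if z \<in> D then F z else 0)"
    "stem_of D (slice_fun D G) = (\<lambda>z. if z \<in> D then G z else 0)"
    using stem_of_slice_fun[OF D F] stem_of_slice_fun[OF D G] by blast+
  then show ?thesis
    unfolding star_prod_def by (intro slice_fun_cong) simp
qed

end

theory Submission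
  imports Defs "HOL-Complex_Analysis.Complex_Analysis"
begin

text \<open>
  In real coordinates a stem function is a family of holomorphic functions \<open>F\<^sub>v\<close> commuting with
  complex conjugation, and \<open>N(F)\<close> is \<open>h = \<Sum>\<^sub>v F\<^sub>v\<^sup>2\<close>. A stem function with values in \<open>\<complex>\<^sub>I\<close> has the
  form \<open>G = G\<^sub>0 + G\<^sub>1 I\<close>; put \<open>\<phi> = G\<^sub>0 + \<i> G\<^sub>1\<close> with reflection \<open>\<phi>\<^sup>* = G\<^sub>0 - \<i> G\<^sub>1\<close>. Then
  \<open>N(G) = \<phi> \<phi>\<^sup>*\<close>, all isolated zeros lie in \<open>\<complex>\<^sub>I\<close>, and the multiplicity of a spherical zero is
  determined by the smaller of the orders of \<open>\<phi>\<close> and \<open>\<phi>\<^sup>*\<close>. It remains to write \<open>h = \<phi> \<phi>\<^sup>*\<close> so that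
  at a point of the upper half plane \<open>\<phi>\<close> takes all zeros of \<open>h\<close> except for \<open>m\<close> of them, where
  \<open>m\<close> is the minimal order of the \<open>F\<^sub>v\<close>, and at the conjugate point the remaining \<open>m\<close>. On the real
  axis \<open>h\<close> is a sum of squares of real functions, hence has even order \<open>2 m\<close>.
\<close>

section \<open>Zeros of holomorphic functions\<close>

text \<open>The complexified squared norm vanishes on some nonzero elements, so a zero of h need not
  be a common zero of the F_v. At a nonreal point its order n satisfies only 2 m \<le> n; the excess
  n - 2 m measures cancellation among the squares. Giving \<phi> the order n - m above the axis and
  m below makes the smaller order equal to m, while the orders of \<phi> and its reflection still
  add up to n. On the real axis the two orders coincide, so evenness of n is indispensable there.

  A function with the right zeros misses h only by a zero-free factor, which is removed by a square
  root. This is where simple connectedness of the upper half enters, and positivity on the real axis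
  lets the root be glued to its reflection. The hypothesis on N(f) gives h a finite order at every
  point of \<open>D\<close>.

  Nonassociativity does no harm: the only star products that occur are N(f) and products with stems
  having real components, so one argument in \<open>alt_star_algebra\<close> covers both
  algebras.\<close>

definition power_dvd :: "complex set \<Rightarrow> complex \<Rightarrow> nat \<Rightarrow> (complex \<Rightarrow> complex) \<Rightarrow> bool" where
  "power_dvd D z k f \<longleftrightarrow> (\<exists>g. g holomorphic_on D \<and> (\<forall>w\<in>D. f w = (w - z) ^ k * g w))"

text \<open>As in \<open>power_dvd\<close>, the cofactor is asked for on all of \<open>D\<close> and
  not just near \<open>z\<close>, so it can itself be used as a holomorphic function on
  \<open>D\<close>. No order exists at a point near which \<open>f\<close> vanishes identically,
  whereas such an \<open>f\<close> can be divisible by every power.\<close>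

definition has_order :: "complex set \<Rightarrow> complex \<Rightarrow> nat \<Rightarrow> (complex \<Rightarrow> complex) \<Rightarrow> bool" where
  "has_order D z k f \<longleftrightarrow>
     (\<exists>g. g holomorphic_on D \<and> g z \<noteq> 0 \<and> (\<forall>w\<in>D. f w = (w - z) ^ k * g w))"

lemma has_order_imp_power_dvd: "has_order D z k f \<Longrightarrow> power_dvd D z k f"
  by (auto simp: has_order_def power_dvd_def)

lemma power_dvd_mono:
  assumes "power_dvd D z k f" "j \<le> k"
  shows "power_dvd D z j f"
proof -
  obtain g where g: "g holomorphic_on D" "\<forall>w\<in>D. f w = (w - z) ^ k * g w"
    using assms by (auto simp: power_dvd_def)
  have "f w = (w - z) ^ j * ((w - z) ^ (k - j) * g w)" if "w \<in> D" for w
    using g(2) that assms(2) by (simp flip: mult.assoc power_add)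
  moreover have "(\<lambda>w. (w - z) ^ (k - j) * g w) holomorphic_on D"
    by (intro holomorphic_intros g)
  ultimately show ?thesis unfolding power_dvd_def by blast
qed

lemma power_dvd_add:
  assumes "power_dvd D z k f" "power_dvd D z k g"
  shows "power_dvd D z k (\<lambda>w. f w + g w)"
proof -
  obtain f' g' where "f' holomorphic_on D" "\<forall>w\<in>D. f w = (w - z) ^ k * f' w"
    "g' holomorphic_on D" "\<forall>w\<in>D. g w = (w - z) ^ k * g' w"
    using assms by (auto simp: power_dvd_def)
  then show ?thesis unfolding power_dvd_def
    by (intro exI[of _ "\<lambda>w. f' w + g' w"]) (auto intro!: holomorphic_intros simp: algebra_simps)
qed

lemma power_dvd_cmult:
  assumes "power_dvd D z k f"
  shows "power_dvd D z k (\<lambda>w. c * f w)"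
proof -
  obtain f' where "f' holomorphic_on D" "\<forall>w\<in>D. f w = (w - z) ^ k * f' w"
    using assms by (auto simp: power_dvd_def)
  then show ?thesis unfolding power_dvd_def
    by (intro exI[of _ "\<lambda>w. c * f' w"]) (auto intro!: holomorphic_intros simp: algebra_simps)
qed

lemma power_dvd_zero: "power_dvd D z k (\<lambda>w. 0)"
  unfolding power_dvd_def by (intro exI[of _ "\<lambda>w. 0"]) auto

lemma power_dvd_sum:
  assumes "\<And>i. i \<in> S \<Longrightarrow> power_dvd D z k (f i)"
  shows "power_dvd D z k (\<lambda>w. \<Sum>i\<in>S. f i w)"
  using assms by (induction S rule: infinite_finite_induct) (auto intro: power_dvd_zero power_dvd_add)

lemma power_dvd_power2:
  assumes "power_dvd D z k f"
  shows "power_dvd D z (2 * k) (\<lambda>w. (f w)\<^sup>2)"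
proof -
  obtain f' where "f' holomorphic_on D" "\<forall>w\<in>D. f w = (w - z) ^ k * f' w"
    using assms by (auto simp: power_dvd_def)
  then show ?thesis unfolding power_dvd_def
    by (intro exI[of _ "\<lambda>w. (f' w)\<^sup>2"])
      (auto intro!: holomorphic_intros simp: power_mult_distrib mult.commute simp flip: power_mult)
qed

lemma power_dvd_cong:
  assumes "\<And>w. w \<in> D \<Longrightarrow> f w = g w"
  shows "power_dvd D z k f \<longleftrightarrow> power_dvd D z k g"
  using assms by (auto simp: power_dvd_def)

lemma has_order_cong:
  assumes "\<And>w. w \<in> D \<Longrightarrow> f w = g w"
  shows "has_order D z k f \<longleftrightarrow> has_order D z k g"
  using assms by (auto simp: has_order_def)

section \<open>Uniqueness and existence of orders, quotients\<close>

lemma eventually_in_punctured_open: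
  assumes "open D" "z \<in> D"
  shows "\<forall>\<^sub>F w in at z. w \<in> D \<and> w \<noteq> (z::complex)"
  using eventually_at_in_open[OF assms] by (rule eventually_mono) auto

lemma holomorphic_tendsto:
  assumes "open D" "z \<in> D" "g holomorphic_on D"
  shows "(g \<longlongrightarrow> g z) (at z)"
  using assms continuous_on_eq_continuous_at holomorphic_on_imp_continuous_on isCont_def by blast

text \<open>If \<open>n < k\<close>, cancelling the power \<open>n\<close> away from
  \<open>z\<close> leaves \<open>g\<close> with a positive power of \<open>w - z\<close>, and the
  limit at \<open>z\<close> forces \<open>g z = 0\<close>.\<close>

lemma power_dvd_le_order:
  assumes D: "open D" "z \<in> D" and "has_order D z n f" "power_dvd D z k f"
  shows "k \<le> n"
proof (rule ccontr)
  assume "\<not> k \<le> n"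
  obtain g where g: "g holomorphic_on D" "g z \<noteq> 0" "\<forall>w\<in>D. f w = (w - z) ^ n * g w"
    using assms by (auto simp: has_order_def)
  obtain q where q: "q holomorphic_on D" "\<forall>w\<in>D. f w = (w - z) ^ k * q w"
    using assms by (auto simp: power_dvd_def)
  have "\<forall>\<^sub>F w in at z. (w - z) ^ (k - n) * q w = g w"
    using eventually_in_punctured_open[OF D]
  proof eventually_elim
    case (elim w)
    have "(w - z) ^ n * g w = (w - z) ^ n * ((w - z) ^ (k - n) * q w)"
      using g(3) q(2) elim \<open>\<not> k \<le> n\<close> by (simp flip: mult.assoc power_add)
    then show ?case using elim by simp
  qed
  moreover have "((\<lambda>w. (w - z) ^ (k - n) * q w) \<longlongrightarrow> (z - z) ^ (k - n) * q z) (at z)"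
    by (intro tendsto_intros holomorphic_tendsto[OF D q(1)])
  ultimately have "(g \<longlongrightarrow> 0) (at z)"
    using \<open>\<not> k \<le> n\<close> by (auto simp: power_0_left elim: Lim_transform_eventually)
  with holomorphic_tendsto[OF D g(1)] g(2) show False
    using tendsto_unique[OF at_neq_bot] by blast
qed

lemma has_order_unique:
  assumes "open D" "z \<in> D" "has_order D z n f" "has_order D z k f"
  shows "n = k"
  by (meson assms has_order_imp_power_dvd le_antisym power_dvd_le_order)

lemma power_dvd_iff_le_order:
  assumes "open D" "z \<in> D" "has_order D z n f"
  shows "power_dvd D z k f \<longleftrightarrow> k \<le> n"
  using assms has_order_imp_power_dvd power_dvd_le_order power_dvd_mono by blast

lemma factor_out_zero:
  assumes "open D" "g holomorphic_on D" "g z = 0"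
  obtains q where "q holomorphic_on D" "\<And>w. w \<in> D \<Longrightarrow> g w = (w - z) * q w"
proof
  show "(\<lambda>w. if w = z then deriv g z else (g w - g z) / (w - z)) holomorphic_on D"
    using assms by (intro pole_lemma_open)
qed (use assms in auto)

lemma has_order_mult:
  assumes "has_order D z n f" "has_order D z k g"
  shows "has_order D z (n + k) (\<lambda>w. f w * g w)"
proof -
  obtain f' g' where "f' holomorphic_on D" "\<forall>w\<in>D. f w = (w - z) ^ n * f' w" "f' z \<noteq> 0"
    "g' holomorphic_on D" "\<forall>w\<in>D. g w = (w - z) ^ k * g' w" "g' z \<noteq> 0"
    using assms by (auto simp: has_order_def)
  then show ?thesis unfolding has_order_def
    by (intro exI[of _ "\<lambda>w. f' w * g' w"]) (auto intro!: holomorphic_intros simp: power_add)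
qed

lemma has_order_eventually_nonzero:
  assumes D: "open D" "z \<in> D" and "has_order D z n f"
  shows "\<forall>\<^sub>F w in at z. f w \<noteq> 0"
proof -
  obtain g where g: "g holomorphic_on D" "g z \<noteq> 0" "\<forall>w\<in>D. f w = (w - z) ^ n * g w"
    using assms by (auto simp: has_order_def)
  have "\<forall>\<^sub>F w in at z. g w \<noteq> 0"
    using holomorphic_tendsto[OF D g(1)] g(2) by (rule tendsto_imp_eventually_ne)
  then show ?thesis
    using eventually_in_punctured_open[OF D] by eventually_elim (use g in auto)
qed

lemma has_order_eq_0:
  assumes "z \<in> D" "has_order D z n f"
  shows "f z = 0 \<longleftrightarrow> n > 0"
  using assms by (cases n) (auto simp: has_order_def)

text \<open>If all cofactors of the largest common power vanished at \<open>z\<close>, one more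
  factor could be split off. The bound is a hypothesis because it has two sources:
  \<open>zorder\<close> for a single function, and the order of the sum of squares for the
  coordinates of a stem.\<close>

lemma max_common_power:
  assumes D: "open D" and hol: "\<And>i. i \<in> S \<Longrightarrow> f i holomorphic_on D"
    and bound: "\<And>k. (\<And>i. i \<in> S \<Longrightarrow> power_dvd D z k (f i)) \<Longrightarrow> k \<le> N"
  obtains m g where "\<And>i. i \<in> S \<Longrightarrow> g i holomorphic_on D"
    "\<And>i w. i \<in> S \<Longrightarrow> w \<in> D \<Longrightarrow> f i w = (w - z) ^ m * g i w" "\<exists>i\<in>S. g i z \<noteq> 0"
proof -
  define P where "P = (\<lambda>k. \<forall>i\<in>S. power_dvd D z k (f i))"
  define m where "m = (GREATEST k. P k)"
  have "P 0" using hol by (auto simp: P_def power_dvd_def)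
  have P: "P m" and max: "P k \<Longrightarrow> k \<le> m" for k
    unfolding m_def using GreatestI_nat[of P 0 N] Greatest_le_nat[of P _ N] \<open>P 0\<close> bound
    by (auto simp: P_def)
  obtain g where g: "\<And>i. i \<in> S \<Longrightarrow> g i holomorphic_on D"
    "\<And>i w. i \<in> S \<Longrightarrow> w \<in> D \<Longrightarrow> f i w = (w - z) ^ m * g i w"
    using P unfolding P_def power_dvd_def by metis
  have "\<exists>i\<in>S. g i z \<noteq> 0"
  proof (rule ccontr)
    assume "\<not> ?thesis"
    then have zero: "g i z = 0" if "i \<in> S" for i using that by blast
    have "power_dvd D z (Suc m) (f i)" if i: "i \<in> S" for i
    proof -
      obtain q where q: "q holomorphic_on D" "\<And>w. w \<in> D \<Longrightarrow> g i w = (w - z) * q w"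
        using factor_out_zero[OF D g(1)[OF i] zero[OF i]] by blast
      then show ?thesis unfolding power_dvd_def using g(2)[OF i] by (auto simp: ac_simps)
    qed
    then have "P (Suc m)" by (simp add: P_def)
    from max[OF this] show False by simp
  qed
  with g show ?thesis by (intro that) auto
qed

text \<open>\<open>zorder\<close> describes \<open>f\<close> only on a small disc. It serves to
  bound the exponents; the cofactor on all of \<open>D\<close> then comes from
  \<open>max_common_power\<close>, applied to a one-element family.\<close>

lemma ex_has_order:
  assumes D: "open D" "z \<in> D" and hol: "f holomorphic_on D" and nz: "\<forall>\<^sub>F w in at z. f w \<noteq> 0"
  obtains n where "has_order D z n f"
proof -
  obtain r where r: "r > 0" "ball z r \<subseteq> D" using D by (meson openE)
  have "\<forall>\<^sub>F w in at z. f w \<noteq> 0 \<and> w \<in> ball z r"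
    using nz eventually_in_punctured_open[of "ball z r" z] r(1)
    by (auto simp: eventually_conj_iff elim: eventually_mono)
  then obtain w where w: "f w \<noteq> 0" "w \<in> ball z r"
    using eventually_happens[of _ "at z"] by (metis (mono_tags, lifting) at_neq_bot)
  have "\<exists>s>0. cball z s \<subseteq> ball z r \<and> zor_poly f z holomorphic_on cball z s \<and>
      (\<forall>w\<in>cball z s. f w = zor_poly f z w * (w - z) ^ nat (zorder f z) \<and> zor_poly f z w \<noteq> 0)"
    using zorder_exist_zero[of f "ball z r" z] r(1) w holomorphic_on_subset[OF hol r(2)]
    by (meson centre_in_ball connected_ball open_ball)
  then obtain s where s: "s > 0" "cball z s \<subseteq> ball z r" "zor_poly f z holomorphic_on cball z s"
    "\<And>w. w \<in> cball z s \<Longrightarrow> f w = zor_poly f z w * (w - z) ^ nat (zorder f z) \<and> zor_poly f z w \<noteq> 0"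
    by blast
  define N where "N = nat (zorder f z)"
  have ord: "has_order (ball z s) z N f"
    unfolding has_order_def N_def
  proof (intro exI[of _ "zor_poly f z"] conjI ballI)
    show "zor_poly f z holomorphic_on ball z s"
      using s(3) ball_subset_cball holomorphic_on_subset by blast
    show "zor_poly f z z \<noteq> 0" using s(4)[of z] s(1) by simp
    show "f w = (w - z) ^ nat (zorder f z) * zor_poly f z w" if "w \<in> ball z s" for w
      using s(4)[of w] that by simp
  qed
  have "ball z s \<subseteq> D" using s(2) r(2) ball_subset_cball by blast
  then have "power_dvd (ball z s) z k f" if "power_dvd D z k f" for k
    using that unfolding power_dvd_def by (meson holomorphic_on_subset subsetD)
  then have bound: "k \<le> N" if "power_dvd D z k f" for k
    using power_dvd_le_order[OF open_ball _ ord, of k] that s(1) by auto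
  show ?thesis
  proof (rule max_common_power[of D "{()}" "\<lambda>_. f" z N])
    fix m and g :: "unit \<Rightarrow> complex \<Rightarrow> complex"
    assume "\<And>i. i \<in> {()} \<Longrightarrow> g i holomorphic_on D" "\<exists>i\<in>{()}. g i z \<noteq> 0"
      "\<And>i w. i \<in> {()} \<Longrightarrow> w \<in> D \<Longrightarrow> f w = (w - z) ^ m * g i w"
    then have "has_order D z m f"
      unfolding has_order_def by (intro exI[of _ "g ()"]) simp
    then show ?thesis by (rule that)
  qed (use D(1) hol bound in auto)
qed

lemma has_order_quotient:
  assumes D: "open D" and f: "\<And>z. z \<in> D \<Longrightarrow> has_order D z (n z) f"
    and p: "\<And>z. z \<in> D \<Longrightarrow> has_order D z (n z) p"
  obtains u where "u holomorphic_on D" "\<And>z. z \<in> D \<Longrightarrow> u z \<noteq> 0" "\<And>z. z \<in> D \<Longrightarrow> f z = u z * p z"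
proof -
  obtain a where a: "\<And>z. z \<in> D \<Longrightarrow> a z holomorphic_on D" "\<And>z. z \<in> D \<Longrightarrow> a z z \<noteq> 0"
    "\<And>z w. z \<in> D \<Longrightarrow> w \<in> D \<Longrightarrow> f w = (w - z) ^ n z * a z w"
    using f unfolding has_order_def by metis
  obtain b where b: "\<And>z. z \<in> D \<Longrightarrow> b z holomorphic_on D" "\<And>z. z \<in> D \<Longrightarrow> b z z \<noteq> 0"
    "\<And>z w. z \<in> D \<Longrightarrow> w \<in> D \<Longrightarrow> p w = (w - z) ^ n z * b z w"
    using p unfolding has_order_def by metis
  \<comment> \<open>Each value of \<open>u\<close> is read off from the two cofactors belonging to
    that very point. Near \<open>z\<close> the common power cancels, so \<open>u\<close> agrees with
    the quotient of the cofactors belonging to \<open>z\<close>, which is holomorphic there.\<close>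
  define u where "u z = a z z / b z z" for z
  show ?thesis
  proof
    show "u z \<noteq> 0" if "z \<in> D" for z using a b that by (simp add: u_def)
    show fu: "f z = u z * p z" if "z \<in> D" for z
      using a(3)[OF that that] b(3)[OF that that] b(2)[OF that] by (simp add: u_def)
    show "u holomorphic_on D"
    proof (rule analytic_imp_holomorphic, subst analytic_on_def, intro ballI)
      fix z assume z: "z \<in> D"
      have "\<forall>\<^sub>F w in nhds z. b z w \<noteq> 0"
        using tendsto_imp_eventually_ne[OF holomorphic_tendsto[OF D z b(1)[OF z]] b(2)[OF z]] b(2)[OF z]
        by (simp add: eventually_nhds_conv_at)
      moreover have "\<forall>\<^sub>F w in nhds z. w \<in> D"
        using z D eventually_nhds by blast
      ultimately have "\<forall>\<^sub>F w in nhds z. b z w \<noteq> 0 \<and> w \<in> D" by (rule eventually_conj)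
      then obtain e where e: "e > 0" "\<And>w. dist w z < e \<Longrightarrow> b z w \<noteq> 0 \<and> w \<in> D"
        unfolding eventually_nhds_metric by blast
      have eq: "a z w / b z w = u w" if "w \<in> ball z e" for w
      proof (cases "w = z")
        case False
        have w: "w \<in> D" "b z w \<noteq> 0" using e(2)[of w] that by (auto simp: dist_commute)
        have "(w - z) ^ n z * a z w = u w * ((w - z) ^ n z * b z w)"
          using fu[OF w(1)] a(3)[OF z w(1)] b(3)[OF z w(1)] by simp
        then show ?thesis using w(2) False by (simp add: field_simps)
      qed (simp add: u_def)
      have "ball z e \<subseteq> D" using e(2) by (auto simp: dist_commute)
      then have "(\<lambda>w. a z w / b z w) holomorphic_on ball z e"
        using a(1)[OF z] b(1)[OF z] e(2)
        by (intro holomorphic_on_divide) (auto simp: dist_commute intro: holomorphic_on_subset)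
      then have "u holomorphic_on ball z e"
        using eq by (rule holomorphic_transform)
      with e(1) show "\<exists>e>0. u holomorphic_on ball z e" by blast
    qed
  qed
qed

section \<open>The Weierstrass theorem on an open set\<close>

text \<open>The bound is what \<open>weierstrass_factor_bound\<close> yields for an argument of norm
  at most 1/2. It is asked for only eventually on each compact set, since finitely many factors have
  their zeros there. Absolute convergence ensures that the product vanishes only where a factor
  does.\<close>

lemma holomorphic_infinite_product:
  fixes g :: "nat \<Rightarrow> complex \<Rightarrow> complex"
  assumes D: "open D" and hol: "\<And>n. g n holomorphic_on D"
    and bound: "\<And>K. compact K \<Longrightarrow> K \<subseteq> D \<Longrightarrow>
      \<forall>\<^sub>F n in sequentially. \<forall>z\<in>K. norm (g n z - 1) \<le> 3 * (1/2) ^ Suc n"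
  obtains f where "f holomorphic_on D" "\<And>z. z \<in> D \<Longrightarrow> (\<lambda>m. \<Prod>n<m. g n z) \<longlonglongrightarrow> f z"
    "\<And>z. z \<in> D \<Longrightarrow> (\<And>n. g n z \<noteq> 0) \<Longrightarrow> f z \<noteq> 0"
proof
  define f where "f z = (\<Prod>n. g n z)" for z
  have summable: "summable (\<lambda>n. 3 * (1/2 :: real) ^ Suc n)"
    by (intro summable_mult) (simp add: summable_geometric)
  have conv: "convergent_prod (\<lambda>n. g n z)" if "z \<in> D" for z
  proof -
    have "summable (\<lambda>n. norm (g n z - 1))"
      using bound[of "{z}"] that by (intro summable_comparison_test_ev[OF _ summable]) auto
    then show ?thesis
      by (simp add: abs_convergent_prod_conv_summable abs_convergent_prod_imp_convergent_prod)
  qed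
  have lim: "(\<lambda>m. \<Prod>n<m. g n z) \<longlonglongrightarrow> f z" if "z \<in> D" for z
    using convergent_prod_LIMSEQ[OF conv[OF that]] filterlim_sequentially_Suc[of "\<lambda>m. \<Prod>n<m. g n z"]
    unfolding f_def lessThan_Suc_atMost by blast
  then show "\<And>z. z \<in> D \<Longrightarrow> (\<lambda>m. \<Prod>n<m. g n z) \<longlonglongrightarrow> f z" .
  show "f z \<noteq> 0" if "z \<in> D" "\<And>n. g n z \<noteq> 0" for z
    using has_prod_eq_0_iff[OF convergent_prod_has_prod[OF conv[OF that(1)]]] that(2)
    unfolding f_def by (metis rangeE)
  show "f holomorphic_on D"
  proof (rule holomorphic_uniform_sequence[OF D])
    show "(\<lambda>z. \<Prod>n<m. g n z) holomorphic_on D" for m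
      by (intro holomorphic_intros hol)
    fix x assume "x \<in> D"
    then obtain d where d: "d > 0" "cball x d \<subseteq> D" using D open_contains_cball by blast
    have "uniformly_convergent_on (cball x d) (\<lambda>m z. \<Prod>n<m. g n z)"
    proof (rule uniformly_convergent_on_prod')
      show "continuous_on (cball x d) (g n)" for n
        using hol d by (meson holomorphic_on_imp_continuous_on holomorphic_on_subset)
      show "uniformly_convergent_on (cball x d) (\<lambda>N z. \<Sum>n<N. norm (g n z - 1))"
        using bound[of "cball x d"] d by (intro Weierstrass_m_test'_ev[OF _ summable]) auto
    qed simp
    then obtain l where l: "uniform_limit (cball x d) (\<lambda>m z. \<Prod>n<m. g n z) l sequentially"
      by (auto simp: uniformly_convergent_on_def)
    have "l z = f z" if "z \<in> cball x d" for z
      using tendsto_uniform_limitI[OF l that] lim d that LIMSEQ_unique by blast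
    then have "uniform_limit (cball x d) (\<lambda>m z. \<Prod>n<m. g n z) f sequentially"
      using l uniform_limit_cong'[of "cball x d"] by (metis (mono_tags, lifting))
    with d show "\<exists>d>0. cball x d \<subseteq> D \<and> uniform_limit (cball x d) (\<lambda>m z. \<Prod>n<m. g n z) f sequentially"
      by blast
  qed
qed

text \<open>The usual compact exhaustion of an open set. Quantifying over the points of the
  complement, instead of using the distance to it, makes the whole plane an ordinary case.\<close>

definition exhaust :: "complex set \<Rightarrow> real \<Rightarrow> complex set" where
  "exhaust D M = {z. norm z \<le> M \<and> (\<forall>b\<in>-D. inverse M \<le> dist z b)}"

lemma exhaust_compact: "compact (exhaust D M)"
proof -
  have "exhaust D M = cball 0 M \<inter> (\<Inter>b\<in>-D. {z. inverse M \<le> dist z b})"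
    by (auto simp: exhaust_def)
  moreover have "closed {z. inverse M \<le> dist z b}" for b :: complex
    by (intro closed_Collect_le continuous_intros)
  ultimately show ?thesis
    by (metis (no_types, lifting) closed_INT compact_Int_closed compact_cball)
qed

lemma exhaust_subset: "M > 0 \<Longrightarrow> exhaust D M \<subseteq> D"
  by (force simp: exhaust_def)

lemma compact_subset_exhaust:
  assumes D: "open D" and K: "compact K" "K \<subseteq> D"
  obtains M where "M > 0" "K \<subseteq> exhaust D M"
proof -
  obtain R where R: "R > 0" "\<And>z. z \<in> K \<Longrightarrow> norm z \<le> R"
    using compact_imp_bounded[OF K(1)] by (meson bounded_pos)
  have "closed (-D)" "K \<inter> -D = {}" using D K(2) by auto
  then obtain d where d: "d > 0" "\<And>z b. z \<in> K \<Longrightarrow> b \<in> -D \<Longrightarrow> d \<le> dist z b"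
    using separate_compact_closed[OF K(1), of "-D"] by blast
  define M where "M = max R (inverse d)"
  have "inverse M \<le> d"
    using le_imp_inverse_le[of "inverse d" M] d(1) by (simp add: M_def)
  then have "K \<subseteq> exhaust D M"
    using R(2) d(2) unfolding exhaust_def M_def by force
  moreover have "M > 0" using R(1) by (simp add: M_def)
  ultimately show ?thesis using that by blast
qed

text \<open>
  The factor belonging to a zero \<open>a\<close> is an elementary factor in \<open>(a - b) / (w - b)\<close>, where \<open>b\<close> is
  a boundary point nearest to \<open>a\<close>, if \<open>a\<close> is close to the boundary compared to its size, and an
  elementary factor in \<open>w / a\<close> otherwise. Thus zeros may accumulate at the boundary and at infinity.
\<close>

lemma ex_elementary_argument:
  assumes D: "open D" and a: "a \<in> D" "\<not> (D = UNIV \<and> a = 0)"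
  obtains u r where "u holomorphic_on D" "r holomorphic_on D" "\<And>w. w \<in> D \<Longrightarrow> r w \<noteq> 0"
    "\<And>w. w \<in> D \<Longrightarrow> 1 - u w = (w - a) * r w"
    "\<And>L M w. L > 0 \<Longrightarrow> 2 * L \<le> M \<Longrightarrow> a \<notin> exhaust D M \<Longrightarrow> w \<in> exhaust D L \<Longrightarrow> norm (u w) \<le> 1/2"
proof (cases "\<exists>b. b \<in> -D \<and> (\<forall>b'\<in>-D. dist a b \<le> dist a b') \<and> dist a b * norm a \<le> 1")
  \<comment> \<open>A point \<open>a\<close> outside \<open>exhaust D M\<close> has norm above
    \<open>M\<close> or distance less than \<open>inverse M\<close> to the complement. The threshold
    1 on the product of distance and norm turns both alternatives into one: here the distance is at
    most \<open>inverse M\<close>, in the other case the norm is at least \<open>M\<close>. Since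
    \<open>2 * L \<le> M\<close>, either quotient then has norm at most 1/2 on
    \<open>exhaust D L\<close>.\<close>
  case True
  then obtain b where b: "b \<in> -D" "\<And>b'. b' \<in> -D \<Longrightarrow> dist a b \<le> dist a b'" "dist a b * norm a \<le> 1"
    by blast
  have nz: "w \<noteq> b" if "w \<in> D" for w using that b(1) by auto
  show ?thesis
  proof
    show "(\<lambda>w. (a - b) / (w - b)) holomorphic_on D" "(\<lambda>w. 1 / (w - b)) holomorphic_on D"
      by (intro holomorphic_intros; use nz in force)+
    show "1 / (w - b) \<noteq> 0" "1 - (a - b) / (w - b) = (w - a) * (1 / (w - b))" if "w \<in> D" for w
      using nz[OF that] by (auto simp: field_simps)
    fix L M w assume LM: "L > 0" "2 * L \<le> M" "a \<notin> exhaust D M" "w \<in> exhaust D L"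
    have "dist a b \<le> inverse M"
    proof (cases "norm a > M")
      case True
      have "dist a b * M \<le> dist a b * norm a" using True by (intro mult_left_mono) auto
      with b(3) have "dist a b * M \<le> 1" by linarith
      then show ?thesis using LM by (simp add: field_simps)
    next
      case False
      then obtain b' where "b' \<in> -D" "dist a b' < inverse M"
        using LM(3) by (auto simp: exhaust_def not_le)
      then show ?thesis using b(2)[of b'] by linarith
    qed
    also have "\<dots> \<le> inverse L / 2" using LM by (simp add: field_simps)
    also have "\<dots> \<le> dist w b / 2" using LM(4) b(1) by (auto simp: exhaust_def)
    finally have "norm (a - b) \<le> norm (w - b) / 2" by (simp add: dist_norm)
    then show "norm ((a - b) / (w - b)) \<le> 1/2"
      by (cases "w = b") (auto simp: norm_divide field_simps)
  qed
next
  case False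
  have a0: "a \<noteq> 0"
  proof
    assume "a = 0"
    then have "-D \<noteq> {}" using a by auto
    then obtain b where "b \<in> -D" "\<And>b'. b' \<in> -D \<Longrightarrow> dist a b \<le> dist a b'"
      using distance_attains_inf[of "-D" a] D by (metis closed_Compl)
    with False \<open>a = 0\<close> show False by auto
  qed
  show ?thesis
  proof
    show "(\<lambda>w. w / a) holomorphic_on D" "(\<lambda>w. - 1 / a) holomorphic_on D"
      using a0 by (intro holomorphic_intros; simp)+
    show "- 1 / a \<noteq> 0" "1 - w / a = (w - a) * (- 1 / a)" for w
      using a0 by (auto simp: field_simps)
    fix L M w assume LM: "L > 0" "2 * L \<le> M" "a \<notin> exhaust D M" "w \<in> exhaust D L"
    have "norm a \<ge> M"
    proof (rule ccontr)
      assume less: "\<not> norm a \<ge> M"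
      then obtain b' where b': "b' \<in> -D" "dist a b' < inverse M"
        using LM(3) by (auto simp: exhaust_def not_le)
      then obtain b where b: "b \<in> -D" "\<And>b'. b' \<in> -D \<Longrightarrow> dist a b \<le> dist a b'"
        using distance_attains_inf[of "-D" a] D by (metis closed_Compl empty_iff)
      have "dist a b * norm a \<le> inverse M * M"
        using b(2)[OF b'(1)] b'(2) less LM by (intro mult_mono) auto
      with False b LM show False by auto
    qed
    then have "2 * L \<le> norm a" using LM by linarith
    moreover have "norm w \<le> L" using LM by (simp add: exhaust_def)
    ultimately show "norm (w / a) \<le> 1/2"
      using a0 by (simp add: norm_divide field_simps)
  qed
qed

lemma ex_elementary_factor:
  assumes D: "open D" and a: "a \<in> D"
  obtains E k where "\<And>n. E n holomorphic_on D" "\<And>n. k n holomorphic_on D"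
    "\<And>n w. w \<in> D \<Longrightarrow> E n w = (w - a) * k n w" "\<And>n w. w \<in> D \<Longrightarrow> k n w \<noteq> 0"
    "\<And>L M n w. L > 0 \<Longrightarrow> 2 * L \<le> M \<Longrightarrow> a \<notin> exhaust D M \<Longrightarrow> w \<in> exhaust D L \<Longrightarrow>
       norm (E n w - 1) \<le> 3 * (1/2) ^ Suc n"
proof (cases "D = UNIV \<and> a = 0")
  \<comment> \<open>At the origin of the whole plane neither quotient is available. The plain factor
    suffices: 0 lies in \<open>exhaust UNIV M\<close> for every positive \<open>M\<close>, so the
    estimate is vacuous.\<close>
  case True
  show ?thesis
  proof
    show "(\<lambda>w. w - a) holomorphic_on D" "(\<lambda>w. 1) holomorphic_on D"
      by (intro holomorphic_intros)+
    show "w - a = (w - a) * 1" "(1::complex) \<noteq> 0" for w by auto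
    fix L M :: real and n :: nat and w assume "L > 0" "2 * L \<le> M" "a \<notin> exhaust D M"
    then show "norm (w - a - 1) \<le> 3 * (1/2) ^ Suc n"
      using True by (simp add: exhaust_def)
  qed
next
  case False
  obtain u r where ur: "u holomorphic_on D" "r holomorphic_on D" "\<And>w. w \<in> D \<Longrightarrow> r w \<noteq> 0"
    "\<And>w. w \<in> D \<Longrightarrow> 1 - u w = (w - a) * r w"
    "\<And>L M w. L > 0 \<Longrightarrow> 2 * L \<le> M \<Longrightarrow> a \<notin> exhaust D M \<Longrightarrow> w \<in> exhaust D L \<Longrightarrow> norm (u w) \<le> 1/2"
    using ex_elementary_argument[OF D a False] by metis
  show ?thesis
  proof
    show "(\<lambda>w. weierstrass_factor n (u w)) holomorphic_on D"
      "(\<lambda>w. r w * exp (\<Sum>k=1..n. u w ^ k / of_nat k)) holomorphic_on D" for n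
      by (intro holomorphic_intros ur; simp)+
    show "weierstrass_factor n (u w) = (w - a) * (r w * exp (\<Sum>k=1..n. u w ^ k / of_nat k))"
      "r w * exp (\<Sum>k=1..n. u w ^ k / of_nat k) \<noteq> 0" if "w \<in> D" for n w
      using ur(3,4)[OF that] by (auto simp: weierstrass_factor_def)
    fix L M :: real and n :: nat and w
    assume "L > 0" "2 * L \<le> M" "a \<notin> exhaust D M" "w \<in> exhaust D L"
    then have *: "norm (u w) \<le> 1/2" by (rule ur(5))
    then have "norm (weierstrass_factor n (u w) - 1) \<le> 3 * norm (u w) ^ Suc n"
      by (rule weierstrass_factor_bound)
    also have "\<dots> \<le> 3 * (1/2) ^ Suc n"
      using * by (intro mult_left_mono power_mono) auto
    finally show "norm (weierstrass_factor n (u w) - 1) \<le> 3 * (1/2) ^ Suc n" .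
  qed
qed

theorem weierstrass_open:
  fixes c :: "complex \<Rightarrow> nat"
  assumes D: "open D" and discrete: "\<And>z. z \<in> D \<Longrightarrow> \<forall>\<^sub>F w in at z. c w = 0"
  obtains f where "f holomorphic_on D" "\<And>z. z \<in> D \<Longrightarrow> has_order D z (c z) f"
proof -
  define Z where "Z = {z. c z \<noteq> 0}"
  have sparse: "Z sparse_in D"
    using discrete by (simp add: sparse_in_eventually_iff[OF D] Z_def)
  \<comment> \<open>\<open>S\<close> contains \<open>c z\<close> copies of each zero
    \<open>z\<close>. The copies receive distinct indices under \<open>i\<close>, so
    \<open>z\<close> will occur in exactly \<open>c z\<close> factors.\<close>
  define S where "S = (SIGMA z:D \<inter> Z. {..<c z})"
  have "countable S"
    unfolding S_def by (intro countable_SIGMA sparse_imp_countable[OF D sparse]) auto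
  then obtain i :: "complex \<times> nat \<Rightarrow> nat" where i: "inj_on i S"
    by (auto simp: countable_def)
  define a where "a n = fst (inv_into S i n)" for n
  have a_i: "a (i s) = fst s" if "s \<in> S" for s
    using i that by (simp add: a_def)
  have a_D: "a n \<in> D" if "n \<in> i ` S" for n
    using that a_i by (auto simp: S_def)
  define P where "P a E k \<longleftrightarrow> (\<forall>n. E n holomorphic_on D \<and> k n holomorphic_on D \<and>
      (\<forall>w\<in>D. E n w = (w - a) * k n w \<and> k n w \<noteq> 0)) \<and>
      (\<forall>L M n w. L > 0 \<longrightarrow> 2 * L \<le> M \<longrightarrow> a \<notin> exhaust D M \<longrightarrow> w \<in> exhaust D L \<longrightarrow>
       norm (E n w - 1) \<le> 3 * (1/2) ^ Suc n)" for a and E k :: "nat \<Rightarrow> complex \<Rightarrow> complex"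
  have "\<exists>E k. P a E k" if a: "a \<in> D" for a
  proof (rule ex_elementary_factor[OF D a])
    fix E k
    assume "\<And>n. E n holomorphic_on D" "\<And>n. k n holomorphic_on D"
      "\<And>n w. w \<in> D \<Longrightarrow> E n w = (w - a) * k n w" "\<And>n w. w \<in> D \<Longrightarrow> k n w \<noteq> 0"
      "\<And>L M n w. L > 0 \<Longrightarrow> 2 * L \<le> M \<Longrightarrow> a \<notin> exhaust D M \<Longrightarrow> w \<in> exhaust D L \<Longrightarrow>
         norm (E n w - 1) \<le> 3 * (1/2) ^ Suc n"
    then have "P a E k" by (simp add: P_def)
    then show ?thesis by blast
  qed
  then obtain E k where P: "\<And>a. a \<in> D \<Longrightarrow> P a (E a) (k a)" by metis
  have Ek: "\<And>a n. a \<in> D \<Longrightarrow> E a n holomorphic_on D" "\<And>a n. a \<in> D \<Longrightarrow> k a n holomorphic_on D"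
    "\<And>a n w. a \<in> D \<Longrightarrow> w \<in> D \<Longrightarrow> E a n w = (w - a) * k a n w"
    "\<And>a n w. a \<in> D \<Longrightarrow> w \<in> D \<Longrightarrow> k a n w \<noteq> 0"
    "\<And>a L M n w. a \<in> D \<Longrightarrow> L > 0 \<Longrightarrow> 2 * L \<le> M \<Longrightarrow> a \<notin> exhaust D M \<Longrightarrow> w \<in> exhaust D L \<Longrightarrow>
       norm (E a n w - 1) \<le> 3 * (1/2) ^ Suc n"
    using P unfolding P_def by blast+
  \<comment> \<open>The index of a factor is also its Weierstrass degree, which makes the bounds
    summable. Indices that number no zero contribute the factor 1.\<close>
  define g where "g n w = (if n \<in> i ` S then E (a n) n w else 1)" for n w
  have g_hol: "g n holomorphic_on D" for n
    using Ek(1)[OF a_D, of n n] unfolding g_def[abs_def] by (cases "n \<in> i ` S") simp_all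
  have fin: "finite {s \<in> S. fst s \<in> K}" if K: "compact K" "K \<subseteq> D" for K
  proof (rule finite_subset)
    show "{s \<in> S. fst s \<in> K} \<subseteq> (SIGMA z:K \<inter> Z. {..<c z})" by (auto simp: S_def)
    show "finite (SIGMA z:K \<inter> Z. {..<c z})"
      using sparse_in_compact_finite[OF sparse_in_subset[OF sparse K(2)] K(1)] by auto
  qed
  have bound: "\<forall>\<^sub>F n in sequentially. \<forall>z\<in>K. norm (g n z - 1) \<le> 3 * (1/2) ^ Suc n"
    if K: "compact K" "K \<subseteq> D" for K
  proof -
    obtain L where L: "L > 0" "K \<subseteq> exhaust D L" using compact_subset_exhaust[OF D K] by blast
    \<comment> \<open>Zeros outside the set with doubled parameter have small factors on
      \<open>exhaust D L\<close>, hence on \<open>K\<close>; only finitely many zeros lie inside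
      it.\<close>
    have "finite (i ` {s \<in> S. fst s \<in> exhaust D (2 * L)})"
      using fin[OF exhaust_compact exhaust_subset, of "2 * L"] L by auto
    then have "\<forall>\<^sub>F n in sequentially. n \<notin> i ` {s \<in> S. fst s \<in> exhaust D (2 * L)}"
      by (metis (no_types, lifting) cofinite_eq_sequentially eventually_cofinite finite_subset mem_Collect_eq not_not subsetI)
    then show ?thesis
    proof eventually_elim
      case (elim n)
      show ?case
      proof
        fix z assume "z \<in> K"
        show "norm (g n z - 1) \<le> 3 * (1/2) ^ Suc n"
        proof (cases "n \<in> i ` S")
          case True
          then have "a n \<notin> exhaust D (2 * L)" using elim a_i by auto
          then show ?thesis
            using Ek(5)[OF a_D[OF True] L(1), of "2 * L" z n] True L(2) \<open>z \<in> K\<close> by (auto simp: g_def)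
        qed (simp add: g_def)
      qed
    qed
  qed
  obtain f where f: "f holomorphic_on D" "\<And>z. z \<in> D \<Longrightarrow> (\<lambda>m. \<Prod>n<m. g n z) \<longlonglongrightarrow> f z"
    using holomorphic_infinite_product[OF D g_hol bound] by metis
  have "has_order D z (c z) f" if z: "z \<in> D" for z
  proof -
    \<comment> \<open>\<open>J\<close> holds the indices of the \<open>c z\<close> factors vanishing
      at \<open>z\<close>, all below \<open>N\<close>. Extracting \<open>w - z\<close> from each
      leaves the functions \<open>k\<close>, nonzero at \<open>z\<close>. No factor from
      \<open>N\<close> on vanishes at \<open>z\<close>, so neither does the tail product
      \<open>t\<close>.\<close>
    define J where "J = {n \<in> i ` S. a n = z}"
    have J: "J = i ` ({z} \<times> {..<c z})"
      using a_i z by (force simp: J_def S_def Z_def)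
    have "inj_on i ({z} \<times> {..<c z})"
      by (rule inj_on_subset[OF i]) (use z in \<open>auto simp: S_def Z_def\<close>)
    then have "card J = c z"
      unfolding J by (simp add: card_image)
    have "finite J" by (simp add: J)
    then obtain N where N: "J \<subseteq> {..<N}" by (meson finite_nat_iff_bounded)
    have tail_bound: "\<forall>\<^sub>F n in sequentially. \<forall>z\<in>K. norm (g (n + N) z - 1) \<le> 3 * (1/2) ^ Suc n"
      if K: "compact K" "K \<subseteq> D" for K
    proof -
      have "\<forall>\<^sub>F n in sequentially. \<forall>z\<in>K. norm (g (n + N) z - 1) \<le> 3 * (1/2) ^ Suc (n + N)"
        using bound[OF K] eventually_sequentially_seg[of "\<lambda>n. \<forall>z\<in>K. norm (g n z - 1) \<le> 3 * (1/2) ^ Suc n" N]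
        by simp
      then show ?thesis
      proof (rule eventually_mono)
        fix n assume "\<forall>z\<in>K. norm (g (n + N) z - 1) \<le> 3 * (1/2) ^ Suc (n + N)"
        moreover have "3 * (1/2 :: real) ^ Suc (n + N) \<le> 3 * (1/2) ^ Suc n"
          by (intro mult_left_mono power_decreasing) auto
        ultimately show "\<forall>z\<in>K. norm (g (n + N) z - 1) \<le> 3 * (1/2) ^ Suc n"
          using order_trans by blast
      qed
    qed
    obtain t where t: "t holomorphic_on D" "\<And>z. z \<in> D \<Longrightarrow> (\<lambda>m. \<Prod>n<m. g (n + N) z) \<longlonglongrightarrow> t z"
      "\<And>z. z \<in> D \<Longrightarrow> (\<And>n. g (n + N) z \<noteq> 0) \<Longrightarrow> t z \<noteq> 0"
      using holomorphic_infinite_product[of D "\<lambda>n. g (n + N)", OF D g_hol tail_bound] by blast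
    have g_nz: "g n z \<noteq> 0" if "n \<notin> J" for n
      using that Ek(3,4)[OF a_D z, of n n] by (auto simp: g_def J_def)
    define q where "q w = (\<Prod>n<N. if n \<in> J then k (a n) n w else g n w) * t w" for w
    show ?thesis
      unfolding has_order_def
    proof (intro exI[of _ q] conjI ballI)
      have hol: "(\<lambda>w. if n \<in> J then k (a n) n w else g n w) holomorphic_on D" for n
        using Ek(2)[OF a_D, of n n] g_hol[of n] by (cases "n \<in> J") (auto simp: J_def)
      then show "q holomorphic_on D"
        unfolding q_def by (intro holomorphic_intros t(1)) auto
      have "n + N \<notin> J" for n using N by auto
      then have "t z \<noteq> 0" using t(3)[OF z] g_nz by blast
      moreover have "(if n \<in> J then k (a n) n z else g n z) \<noteq> 0" for n
        using g_nz Ek(4)[OF a_D z, of n n] by (auto simp: J_def)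
      ultimately show "q z \<noteq> 0" by (simp add: q_def)
      fix w assume w: "w \<in> D"
      have "(\<Prod>n<N. g n w) = (\<Prod>n<N. (if n \<in> J then w - z else 1) * (if n \<in> J then k (a n) n w else g n w))"
        using Ek(3)[OF a_D w] by (intro prod.cong) (auto simp: J_def g_def)
      also have "\<dots> = (\<Prod>n<N. if n \<in> J then w - z else 1) * (\<Prod>n<N. if n \<in> J then k (a n) n w else g n w)"
        by (rule prod.distrib)
      also have "(\<Prod>n<N. if n \<in> J then w - z else 1) = (w - z) ^ c z"
        using N \<open>card J = c z\<close> by (simp add: prod.If_cases inf.absorb2)
      finally have head: "(\<Prod>n<N. g n w) = (w - z) ^ c z * (\<Prod>n<N. if n \<in> J then k (a n) n w else g n w)" .
      have split: "(\<Prod>n<m + N. g n w) = (\<Prod>n<N. g n w) * (\<Prod>n<m. g (n + N) w)" for m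
        by (induction m) (auto simp: algebra_simps)
      have "(\<lambda>m. \<Prod>n<m + N. g n w) \<longlonglongrightarrow> f w"
        using f(2)[OF w] by (rule LIMSEQ_ignore_initial_segment)
      moreover have "(\<lambda>m. \<Prod>n<m + N. g n w) \<longlonglongrightarrow> (\<Prod>n<N. g n w) * t w"
        unfolding split by (intro tendsto_intros t(2)[OF w])
      ultimately have "f w = (\<Prod>n<N. g n w) * t w" by (rule LIMSEQ_unique)
      then show "f w = (w - z) ^ c z * q w" by (simp add: q_def head)
    qed
  qed
  with f(1) show ?thesis using that by blast
qed

section \<open>Reflection in the real axis\<close>

definition reflect :: "(complex \<Rightarrow> complex) \<Rightarrow> complex \<Rightarrow> complex" where
  "reflect f z = cnj (f (cnj z))"

lemma cnj_mem_iff: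
  assumes "cnj ` D = D"
  shows "cnj z \<in> D \<longleftrightarrow> z \<in> D"
  using assms by (metis complex_cnj_cnj image_eqI)

lemma holomorphic_on_reflect:
  assumes "open D" "f holomorphic_on cnj ` D"
  shows "reflect f holomorphic_on D"
  using holomorphic_on_compose_cnj_cnj[OF assms(2,1)] by (simp add: reflect_def[abs_def] o_def)

lemma power_dvd_reflect:
  assumes D: "open D" "cnj ` D = D" and "power_dvd D z k f"
  shows "power_dvd D (cnj z) k (reflect f)"
proof -
  obtain g where "g holomorphic_on D" "\<forall>w\<in>D. f w = (w - z) ^ k * g w"
    using assms by (auto simp: power_dvd_def)
  then show ?thesis unfolding power_dvd_def using D
    by (intro exI[of _ "reflect g"]) (auto simp: holomorphic_on_reflect cnj_mem_iff reflect_def)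
qed

lemma has_order_reflect:
  assumes D: "open D" "cnj ` D = D" and "has_order D z k f"
  shows "has_order D (cnj z) k (reflect f)"
proof -
  obtain g where "g holomorphic_on D" "g z \<noteq> 0" "\<forall>w\<in>D. f w = (w - z) ^ k * g w"
    using assms by (auto simp: has_order_def)
  then show ?thesis unfolding has_order_def using D
    by (intro exI[of _ "reflect g"]) (auto simp: holomorphic_on_reflect cnj_mem_iff reflect_def)
qed

text \<open>
  \<open>D\<close> itself need not be simply connected: it may meet the real axis in several intervals, at which
  a square root chosen on the upper part may take different signs. It is real on each of them, so the
  reflection principle applies.
\<close>

lemma ex_reflection_sqrt:
  assumes D: "open D" "cnj ` D = D" and sc: "simply_connected (D \<inter> {z. Im z > 0})"
    and u: "u holomorphic_on D" "\<And>z. z \<in> D \<Longrightarrow> u z \<noteq> 0" "\<And>z. z \<in> D \<Longrightarrow> u (cnj z) = cnj (u z)"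
    and pos: "\<And>x. x \<in> D \<Longrightarrow> Im x = 0 \<Longrightarrow> Re (u x) > 0"
  obtains \<psi> where "\<psi> holomorphic_on D" "\<And>z. z \<in> D \<Longrightarrow> \<psi> z * reflect \<psi> z = u z"
proof -
  define H where "H = D \<inter> {z. Im z > 0}"
  have H: "open H" unfolding H_def by (intro open_Int D open_halfspace_Im_gt)
  have "u holomorphic_on H" using u(1) by (rule holomorphic_on_subset) (auto simp: H_def)
  then obtain p where p: "p holomorphic_on H" "\<And>z. z \<in> H \<Longrightarrow> u z = (p z)\<^sup>2"
    using sc u(2) unfolding simply_connected_eq_holomorphic_sqrt[OF H[unfolded H_def]]
    by (metis H_def IntD1)
  \<comment> \<open>Where \<open>u\<close> has positive real part, its principal root is
    holomorphic. On the upper half of a small disc the chosen root \<open>p\<close> divided by it is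
    continuous with values 1 and -1, and the half disc is connected, so one sign \<open>s\<close>
    serves for all of it.\<close>
  define Q where "Q x r s \<longleftrightarrow> r > 0 \<and> s \<in> {1,-1} \<and> ball x r \<subseteq> D \<and> (\<forall>w\<in>ball x r. Re (u w) > 0) \<and>
      (\<forall>w\<in>ball x r. Im w > 0 \<longrightarrow> p w = s * csqrt (u w))" for x r s
  have "\<exists>r s. Q x r s" if x: "x \<in> D" "Im x = 0" for x
  proof -
    have "\<forall>\<^sub>F w in nhds x. w \<in> D" using D x eventually_nhds by blast
    moreover have "\<forall>\<^sub>F w in nhds x. Re (u w) > 0"
    proof -
      have "((\<lambda>w. Re (u w)) \<longlongrightarrow> Re (u x)) (at x)"
        by (intro tendsto_intros holomorphic_tendsto[OF D(1) x(1) u(1)])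
      then have "\<forall>\<^sub>F w in at x. Re (u w) > 0"
        using pos[OF x] by (rule order_tendstoD)
      then show ?thesis using pos[OF x] by (simp add: eventually_nhds_conv_at)
    qed
    ultimately have "\<forall>\<^sub>F w in nhds x. w \<in> D \<and> Re (u w) > 0" by (rule eventually_conj)
    then obtain r where r: "r > 0" "\<And>w. dist w x < r \<Longrightarrow> w \<in> D \<and> Re (u w) > 0"
      unfolding eventually_nhds_metric by blast
    define B where "B = ball x r \<inter> {w. Im w > 0}"
    have BH: "w \<in> H" "Re (u w) > 0" "csqrt (u w) \<noteq> 0" if "w \<in> B" for w
      using r(2)[of w] that by (auto simp: B_def H_def dist_commute)
    have "connected B"
      unfolding B_def by (intro convex_connected convex_Int convex_ball convex_halfspace_Im_gt)
    moreover have "continuous_on B (\<lambda>w. p w / csqrt (u w))"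
    proof (intro holomorphic_on_imp_continuous_on holomorphic_on_divide holomorphic_on_csqrt')
      show "p holomorphic_on B" using p(1) BH(1) by (meson holomorphic_on_subset subsetI)
      show "u holomorphic_on B"
        using u(1) BH(1) by (rule_tac holomorphic_on_subset) (auto simp: H_def)
      show "u w \<notin> \<real>\<^sub>\<le>\<^sub>0" if "w \<in> B" for w
        using BH(2)[OF that] by (auto simp: complex_nonpos_Reals_iff)
      show "csqrt (u w) \<noteq> 0" if "w \<in> B" for w using BH(3)[OF that] .
    qed
    moreover have pm: "p w / csqrt (u w) \<in> {1, -1}" if "w \<in> B" for w
    proof -
      have "(p w / csqrt (u w))\<^sup>2 = 1"
        using p(2)[OF BH(1)[OF that]] BH(3)[OF that] by (simp add: power_divide)
      then show ?thesis by (simp add: power2_eq_1_iff)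
    qed
    then have "(\<lambda>w. p w / csqrt (u w)) ` B \<subseteq> {1, -1}" by blast
    then have "finite ((\<lambda>w. p w / csqrt (u w)) ` B)" by (rule finite_subset) simp
    ultimately have "(\<lambda>w. p w / csqrt (u w)) constant_on B"
      by (rule continuous_finite_range_constant)
    then obtain s where s: "\<And>w. w \<in> B \<Longrightarrow> p w / csqrt (u w) = s"
      by (auto simp: constant_on_def)
    have xB: "x + Complex 0 (r/2) \<in> B"
      using r(1) x(2) by (auto simp: B_def dist_norm complex_norm)
    have "s \<in> {1,-1}" using pm[OF xB] unfolding s[OF xB] .
    moreover have "p w = s * csqrt (u w)" if "w \<in> ball x r" "Im w > 0" for w
      using s[of w] BH(3)[of w] that by (auto simp: B_def field_simps)
    moreover have "ball x r \<subseteq> D" "\<forall>w\<in>ball x r. Re (u w) > 0"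
      using r(2) by (auto simp: dist_commute)
    ultimately show ?thesis using r(1) unfolding Q_def by blast
  qed
  then obtain r s where Q: "\<And>x. x \<in> D \<Longrightarrow> Im x = 0 \<Longrightarrow> Q x (r x) (s x)" by metis
  have rs: "\<And>x. x \<in> D \<Longrightarrow> Im x = 0 \<Longrightarrow> r x > 0"
    "\<And>x. x \<in> D \<Longrightarrow> Im x = 0 \<Longrightarrow> s x \<in> {1,-1}"
    "\<And>x. x \<in> D \<Longrightarrow> Im x = 0 \<Longrightarrow> ball x (r x) \<subseteq> D"
    "\<And>x w. x \<in> D \<Longrightarrow> Im x = 0 \<Longrightarrow> w \<in> ball x (r x) \<Longrightarrow> Re (u w) > 0"
    "\<And>x w. x \<in> D \<Longrightarrow> Im x = 0 \<Longrightarrow> w \<in> ball x (r x) \<Longrightarrow> Im w > 0 \<Longrightarrow> p w = s x * csqrt (u w)"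
    using Q unfolding Q_def by blast+
  \<comment> \<open>Below the axis the reflected root is used, on the axis the principal root with
    its local sign. Thus \<open>\<psi>\<close> is its own reflection and squares to
    \<open>u\<close>. Only holomorphy across the axis is at stake, and \<open>near_real\<close>
    reduces it to that of \<open>csqrt\<close>.\<close>
  define \<psi> where "\<psi> z = (if Im z > 0 then p z else if Im z < 0 then cnj (p (cnj z)) else s z * csqrt (u z))" for z
  have near_real: "s x * csqrt (u w) = \<psi> w" if x: "x \<in> D" "Im x = 0" and w: "w \<in> ball x (r x)" for x w
  proof -
    note rx = rs[OF x]
    have wD: "w \<in> D" using rx(3) w by blast
    consider "Im w > 0" | "Im w < 0" | "Im w = 0" by linarith
    then show ?thesis
    proof cases
      case 1
      then show ?thesis using rx(5)[OF w] by (simp add: \<psi>_def)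
    next
      case 2
      have "cnj x = x" using x by (simp add: complex_eq_iff)
      then have "dist x (cnj w) = dist x w"
        by (metis complex_cnj_diff complex_mod_cnj dist_norm)
      then have "cnj w \<in> ball x (r x)" using w by simp
      then have "p (cnj w) = s x * csqrt (cnj (u w))"
        using rx(5)[of "cnj w"] 2 u(3)[OF wD] by simp
      moreover have "u w \<notin> \<real>\<^sub>\<le>\<^sub>0" using rx(4)[OF w] by (auto simp: complex_nonpos_Reals_iff)
      moreover have "cnj (s x) = s x" using rx(2) by auto
      ultimately show ?thesis using 2 by (simp add: \<psi>_def flip: cnj_csqrt)
    next
      case 3
      note rw = rs[OF wD 3]
      \<comment> \<open>The signs at the real points \<open>x\<close> and \<open>w\<close> are
        compared at a point slightly above \<open>w\<close>; \<open>e\<close> is small enough for it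
        to lie in both discs.\<close>
      define e where "e = min (r w) (r x - dist x w) / 2"
      have e: "e > 0" "e < r w" "e < r x - dist x w" using rw(1) w by (auto simp: e_def min_def)
      define y where "y = w + Complex 0 e"
      have "dist w y = e" using e(1) by (simp add: y_def dist_norm complex_norm)
      then have y: "y \<in> ball w (r w)" "y \<in> ball x (r x)"
        using e dist_triangle[of x y w] by auto
      have "Im y > 0" using 3 e(1) by (simp add: y_def)
      then have "s x * csqrt (u y) = s w * csqrt (u y)"
        using rw(5)[OF y(1)] rx(5)[OF y(2)] by simp
      moreover have "csqrt (u y) \<noteq> 0" using rx(4)[OF y(2)] by auto
      ultimately show ?thesis using 3 by (simp add: \<psi>_def)
    qed
  qed
  have "\<psi> holomorphic_on D"
  proof (rule analytic_imp_holomorphic, subst analytic_on_def, intro ballI)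
    fix z assume z: "z \<in> D"
    consider "Im z > 0" | "Im z < 0" | "Im z = 0" by linarith
    then show "\<exists>e>0. \<psi> holomorphic_on ball z e"
    proof cases
      case 1
      then have "z \<in> H" using z by (simp add: H_def)
      then obtain e where e: "e > 0" "ball z e \<subseteq> H" using H by (meson openE)
      have "\<psi> holomorphic_on ball z e"
        using holomorphic_on_subset[OF p(1) e(2)] by (rule holomorphic_transform) (use e(2) in \<open>auto simp: \<psi>_def H_def\<close>)
      with e(1) show ?thesis by blast
    next
      case 2
      have cH: "cnj ` (cnj ` H) = H" "open (cnj ` H)"
        using H by (auto simp: image_image image_cnj_conv_vimage_cnj intro: open_vimage)
      have "cnj z \<in> H" using z 2 D by (simp add: H_def cnj_mem_iff)
      then have "z \<in> cnj ` H" by (metis complex_cnj_cnj image_eqI)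
      then obtain e where e: "e > 0" "ball z e \<subseteq> cnj ` H" using cH by (meson openE)
      have "reflect p holomorphic_on cnj ` H"
        using holomorphic_on_reflect[OF cH(2)] p(1) cH(1) by simp
      then have "reflect p holomorphic_on ball z e" using e(2) by (rule holomorphic_on_subset)
      then have "\<psi> holomorphic_on ball z e"
        by (rule holomorphic_transform) (use e(2) in \<open>force simp: \<psi>_def H_def reflect_def\<close>)
      with e(1) show ?thesis by blast
    next
      case 3
      note rz = rs[OF z 3]
      have "(\<lambda>w. s z * csqrt (u w)) holomorphic_on ball z (r z)"
        using rz(3,4) u(1) by (intro holomorphic_intros)
          (auto intro: holomorphic_on_subset simp: complex_nonpos_Reals_iff not_le)
      then have "\<psi> holomorphic_on ball z (r z)"
        by (rule holomorphic_transform) (rule near_real[OF z 3])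
      with rz(1) show ?thesis by blast
    qed
  qed
  moreover have "\<psi> z * reflect \<psi> z = u z" if z: "z \<in> D" for z
  proof -
    consider "Im z > 0" | "Im z < 0" | "Im z = 0" by linarith
    then show ?thesis
    proof cases
      case 1
      then show ?thesis using p(2)[of z] z by (simp add: \<psi>_def reflect_def H_def power2_eq_square)
    next
      case 2
      then have "u (cnj z) = (p (cnj z))\<^sup>2" using p(2)[of "cnj z"] z D by (simp add: H_def cnj_mem_iff)
      then have "u z = (cnj (p (cnj z)))\<^sup>2" using u(3)[OF z] by (metis complex_cnj_cnj complex_cnj_power)
      with 2 show ?thesis by (simp add: \<psi>_def reflect_def power2_eq_square)
    next
      case 3
      then have "cnj z = z" by (simp add: complex_eq_iff)
      then have "cnj (u z) = u z" using u(3)[OF z] by simp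
      moreover have "u z \<notin> \<real>\<^sub>\<le>\<^sub>0" using pos[OF z 3] by (auto simp: complex_nonpos_Reals_iff)
      ultimately have "cnj (csqrt (u z)) = csqrt (u z)" by (simp add: cnj_csqrt)
      moreover have "csqrt (u z) * csqrt (u z) = u z" by (simp flip: power2_eq_square)
      ultimately show ?thesis
        using 3 rs(2)[OF z 3] \<open>cnj z = z\<close> by (auto simp: \<psi>_def reflect_def)
    qed
  qed
  ultimately show ?thesis using that by blast
qed

lemma eq_by_continuity:
  assumes D: "open D" "z \<in> D" "f holomorphic_on D" "g holomorphic_on D"
    and eq: "\<forall>\<^sub>F w in at z. f w = g w"
  shows "f z = g z"
proof -
  have "(g \<longlongrightarrow> f z) (at z)"
    using holomorphic_tendsto[OF D(1-3)] eq by (rule Lim_transform_eventually)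
  then show ?thesis
    using holomorphic_tendsto[OF D(1,2,4)] tendsto_unique[OF at_neq_bot] by blast
qed

text \<open>
  Weierstrass gives a \<open>\<phi>\<close> with divisor \<open>c\<close>; then \<open>h\<close> divided by \<open>\<phi>\<close> and its reflection is a
  zero-free function, positive on the real axis, whose square root corrects \<open>\<phi>\<close>.
\<close>

theorem reflection_factorization:
  fixes c :: "complex \<Rightarrow> nat"
  assumes D: "open D" "cnj ` D = D" and sc: "simply_connected (D \<inter> {z. Im z > 0})"
    and h: "\<And>z. z \<in> D \<Longrightarrow> has_order D z (c z + c (cnj z)) h"
    and real: "\<And>z. z \<in> D \<Longrightarrow> h (cnj z) = cnj (h z)"
    and nonneg: "\<And>x. x \<in> D \<Longrightarrow> Im x = 0 \<Longrightarrow> Re (h x) \<ge> 0"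
  obtains \<phi> where "\<phi> holomorphic_on D" "\<And>z. z \<in> D \<Longrightarrow> has_order D z (c z) \<phi>"
    "\<And>z. z \<in> D \<Longrightarrow> \<phi> z * reflect \<phi> z = h z"
proof -
  note ev_h = has_order_eventually_nonzero[OF D(1) _ h]
  \<comment> \<open>\<open>h\<close> has no zeros near \<open>z\<close> other than possibly
    \<open>z\<close> itself, and \<open>c\<close> is bounded by its order, so the prescribed zeros
    are discrete.\<close>
  have "\<forall>\<^sub>F w in at z. c w = 0" if z: "z \<in> D" for z
    using ev_h[OF z z] eventually_in_punctured_open[OF D(1) z]
    by eventually_elim (use has_order_eq_0[OF _ h] in force)
  then obtain \<phi> where \<phi>: "\<phi> holomorphic_on D" "\<And>z. z \<in> D \<Longrightarrow> has_order D z (c z) \<phi>"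
    using weierstrass_open[OF D(1), of c] by blast
  define p where "p w = \<phi> w * reflect \<phi> w" for w
  have p: "has_order D z (c z + c (cnj z)) p" if z: "z \<in> D" for z
    using has_order_mult[OF \<phi>(2)[OF z]] has_order_reflect[OF D \<phi>(2)[of "cnj z"]] z D
    unfolding p_def by (simp add: cnj_mem_iff)
  obtain u where u: "u holomorphic_on D" "\<And>z. z \<in> D \<Longrightarrow> u z \<noteq> 0" "\<And>z. z \<in> D \<Longrightarrow> h z = u z * p z"
    using has_order_quotient[OF D(1) h p] by blast
  have u_real: "u (cnj z) = cnj (u z)" if z: "z \<in> D" for z
  proof -
    have "u z = reflect u z"
    proof (rule eq_by_continuity[OF D(1) z u(1)])
      show "reflect u holomorphic_on D" using holomorphic_on_reflect[OF D(1)] u(1) D(2) by simp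
      show "\<forall>\<^sub>F w in at z. u w = reflect u w"
        using ev_h[OF z z] eventually_in_punctured_open[OF D(1) z]
      proof eventually_elim
        case (elim w)
        have "cnj w \<in> D" using elim D by (simp add: cnj_mem_iff)
        then have "cnj (u w * p w) = u (cnj w) * p (cnj w)"
          using real[of w] u(3)[of w] u(3)[of "cnj w"] elim by simp
        moreover have "p (cnj w) = cnj (p w)" by (simp add: p_def reflect_def mult.commute)
        moreover have "p w \<noteq> 0" using elim u(3)[of w] by auto
        ultimately have "cnj (u w) = u (cnj w)" by simp
        then show ?case by (metis complex_cnj_cnj reflect_def)
      qed
    qed
    then show ?thesis by (metis complex_cnj_cnj reflect_def)
  qed
  have u_pos: "Re (u x) > 0" if x: "x \<in> D" "Im x = 0" for x
  proof -
    \<comment> \<open>The sign of \<open>h\<close> is known only at real points, so the limit is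
      taken along \<open>x + t\<close> with real \<open>t\<close> decreasing to 0. There
      \<open>p\<close> is the squared norm of \<open>\<phi>\<close>, nonzero close to
      \<open>x\<close> because \<open>h\<close> is.\<close>
    have lim: "filterlim (\<lambda>t::real. x + of_real t) (at x) (at_right 0)"
      by (intro filterlim_atI) (auto intro!: tendsto_eq_intros eventually_at_right_less simp: eventually_at_filter)
    have "((\<lambda>t. Re (u (x + of_real t))) \<longlongrightarrow> Re (u x)) (at_right (0::real))"
      by (intro tendsto_intros filterlim_compose[OF holomorphic_tendsto[OF D(1) x(1) u(1)] lim])
    moreover have "\<forall>\<^sub>F w in at x. Im w = 0 \<longrightarrow> Re (u w) \<ge> 0"
      using ev_h[OF x(1) x(1)] eventually_in_punctured_open[OF D(1) x(1)]
    proof eventually_elim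
      case (elim w)
      show ?case
      proof
        assume "Im w = 0"
        then have "cnj w = w" by (simp add: complex_eq_iff)
        then have "p w = of_real ((norm (\<phi> w))\<^sup>2)"
          by (simp add: p_def reflect_def flip: complex_norm_square)
        then have "Re (h w) = Re (u w) * (norm (\<phi> w))\<^sup>2" "norm (\<phi> w) \<noteq> 0"
          using u(3)[of w] elim by auto
        then show "Re (u w) \<ge> 0"
          using nonneg[of w] elim \<open>Im w = 0\<close> by (simp add: zero_le_mult_iff)
      qed
    qed
    from eventually_compose_filterlim[OF this lim]
    have "\<forall>\<^sub>F t in at_right (0::real). Re (u (x + of_real t)) \<ge> 0"
      using x(2) by simp
    ultimately have "Re (u x) \<ge> 0"
      by (rule tendsto_lowerbound) simp
    moreover have "cnj x = x" using x(2) by (simp add: complex_eq_iff)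
    then have "u x = cnj (u x)" using u_real[OF x(1)] by simp
    then have "Im (u x) = 0" by (simp add: complex_eq_iff)
    ultimately show ?thesis using u(2)[OF x(1)] by (simp add: complex_eq_iff)
  qed
  obtain \<psi> where \<psi>: "\<psi> holomorphic_on D" "\<And>z. z \<in> D \<Longrightarrow> \<psi> z * reflect \<psi> z = u z"
    using ex_reflection_sqrt[OF D sc u(1,2) u_real u_pos] by blast
  show ?thesis
  proof
    show "(\<lambda>w. \<phi> w * \<psi> w) holomorphic_on D" by (intro holomorphic_intros \<phi> \<psi>)
    show "has_order D z (c z) (\<lambda>w. \<phi> w * \<psi> w)" if z: "z \<in> D" for z
    proof -
      have "\<psi> z \<noteq> 0" using \<psi>(2)[OF z] u(2)[OF z] by auto
      then have "has_order D z 0 \<psi>" unfolding has_order_def using \<psi>(1) by (intro exI[of _ \<psi>]) auto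
      then show ?thesis using has_order_mult[OF \<phi>(2)[OF z]] by fastforce
    qed
    show "\<phi> z * \<psi> z * reflect (\<lambda>w. \<phi> w * \<psi> w) z = h z" if z: "z \<in> D" for z
      using u(3)[OF z] \<psi>(2)[OF z] by (simp add: p_def reflect_def mult_ac flip: \<psi>(2)[OF z])
  qed
qed

section \<open>Holomorphic components of stem functions\<close>

definition component :: "(complex \<Rightarrow> 'a::alt_star_algebra complexified) \<Rightarrow> 'a \<Rightarrow> complex \<Rightarrow> complex" where
  "component F v z = Complex (inner (fst (F z)) v) (inner (snd (F z)) v)"

text \<open>The complex bilinear extension of the squared norm, that is, N as a complex number. It
  vanishes for instance at \<open>(1, I)\<close> with \<open>I\<close> an imaginary unit.\<close>

definition complexified_norm :: "'a::alt_star_algebra complexified \<Rightarrow> complex" where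
  "complexified_norm = (\<lambda>(a, b). Complex ((norm a)\<^sup>2 - (norm b)\<^sup>2) (2 * inner a b))"

lemma component_scaleC: "component (\<lambda>z. cx_scale (p z) (K z)) v z = p z * component K v z"
  by (simp add: component_def cx_scale_def case_prod_unfold complex_eq_iff inner_add_left inner_diff_left)

lemma component_expand:
  "component F w z = (\<Sum>v\<in>Basis. of_real (inner w v) * component F v z)"
  by (simp add: component_def complex_eq_iff euclidean_inner[of _ w] mult.commute)

lemma complexified_eqI:
  assumes "\<And>v. v \<in> Basis \<Longrightarrow> component F v z = component G v z"
  shows "F z = G z"
  using assms by (auto simp: component_def prod_eq_iff intro: euclidean_eqI)

lemma component_eq_0_iff: "(\<forall>v\<in>Basis. component F v z = 0) \<longleftrightarrow> F z = 0"
  using complexified_eqI[of F z "\<lambda>_. 0"] by (auto simp: component_def complex_eq_iff)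

lemma sum_component_power2: "(\<Sum>v\<in>Basis. (component F v z)\<^sup>2) = complexified_norm (F z)"
proof -
  have "(norm a)\<^sup>2 = (\<Sum>v\<in>Basis. (inner a v)\<^sup>2)" for a :: 'a
    unfolding power2_norm_eq_inner by (subst euclidean_inner) (simp add: power2_eq_square)
  then show ?thesis
    by (simp add: complexified_norm_def component_def case_prod_unfold complex_eq_iff power2_eq_square
      sum_subtractf euclidean_inner[of "fst (F z)" "snd (F z)"] sum_distrib_left mult.assoc)
qed

text \<open>The mixed terms are found by polarizing \<open>cjg_norm\<close>, applied to
  \<open>a + b\<close>; no associativity is involved.\<close>

lemma cx_mult_cx_cjg:
  fixes X :: "'a::alt_star_algebra complexified"
  shows "cx_mult X (cx_cjg X) = (Re (complexified_norm X) *\<^sub>R 1, Im (complexified_norm X) *\<^sub>R 1)"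
proof -
  obtain a b where X: "X = (a, b)" by (cases X)
  have "(a + b) * cjg (a + b) = (norm (a + b))\<^sup>2 *\<^sub>R 1" by (rule cjg_norm)
  then have "a * cjg b + b * cjg a = ((norm (a + b))\<^sup>2 - (norm a)\<^sup>2 - (norm b)\<^sup>2) *\<^sub>R 1"
    by (simp add: cjg_add alt_bilinear cjg_norm scaleR_left_diff_distrib algebra_simps)
  also have "(norm (a + b))\<^sup>2 - (norm a)\<^sup>2 - (norm b)\<^sup>2 = 2 * inner a b"
    by (simp add: power2_norm_eq_inner inner_add_left inner_add_right inner_commute)
  finally show ?thesis
    by (simp add: X cx_mult_def cx_cjg_def complexified_norm_def cjg_norm scaleR_left_diff_distrib)
qed

lemma stem_function_iff:
  "stem_function D F \<longleftrightarrow> (\<forall>v\<in>Basis. \<forall>z\<in>D. component F v (cnj z) = cnj (component F v z))"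
proof -
  have "F (cnj z) = cx_bar (F z) \<longleftrightarrow> (\<forall>v\<in>Basis. component F v (cnj z) = cnj (component F v z))" for z
    by (auto simp: component_def cx_bar_def case_prod_unfold prod_eq_iff complex_eq_iff
        euclidean_eq_iff[where 'a='a])
  then show ?thesis by (auto simp: stem_function_def)
qed

text \<open>In each coordinate \<open>cx_scale h\<close> is multiplication by the complex number
  \<open>h\<close>, so the prescribed form of the derivative is complex differentiability of all
  coordinates. Conversely \<open>F'\<close> is assembled from their derivatives.\<close>

lemma stem_holomorphic_iff:
  assumes "open D"
  shows "stem_holomorphic D F \<longleftrightarrow> (\<forall>v\<in>Basis. component F v holomorphic_on D)"
proof
  assume F: "stem_holomorphic D F"
  show "\<forall>v\<in>Basis. component F v holomorphic_on D"
  proof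
    fix v :: 'a
    show "component F v holomorphic_on D"
      unfolding holomorphic_on_open[OF assms]
    proof
      fix z assume "z \<in> D"
      then obtain F' where F': "(F has_derivative (\<lambda>h. cx_scale h F')) (at z)"
        using F by (auto simp: stem_holomorphic_def)
      have "((\<lambda>z. of_real (inner (fst (F z)) v) + \<i> * of_real (inner (snd (F z)) v)) has_derivative
          (\<lambda>h. of_real (inner (fst (cx_scale h F')) v) + \<i> * of_real (inner (snd (cx_scale h F')) v))) (at z)"
        by (intro derivative_intros has_derivative_fst has_derivative_snd F')
      moreover have "of_real (inner (fst (cx_scale h F')) v) + \<i> * of_real (inner (snd (cx_scale h F')) v) =
          Complex (inner (fst F') v) (inner (snd F') v) * h" for h
        by (simp add: cx_scale_def case_prod_unfold complex_eq_iff inner_add_left inner_diff_left algebra_simps)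
      moreover have "component F v = (\<lambda>z. of_real (inner (fst (F z)) v) + \<i> * of_real (inner (snd (F z)) v))"
        by (simp add: component_def fun_eq_iff complex_eq_iff)
      ultimately have "(component F v has_derivative (*) (Complex (inner (fst F') v) (inner (snd F') v))) (at z)"
        by simp
      then show "\<exists>f'. (component F v has_field_derivative f') (at z)"
        unfolding has_field_derivative_def by blast
    qed
  qed
next
  assume hol: "\<forall>v\<in>Basis. component F v holomorphic_on D"
  show "stem_holomorphic D F"
    unfolding stem_holomorphic_def
  proof
    fix z assume z: "z \<in> D"
    define c where "c v = deriv (component F v) z" for v
    define F' where "F' = (\<Sum>v\<in>Basis. Re (c v) *\<^sub>R v, \<Sum>v\<in>Basis. Im (c v) *\<^sub>R v)"
    have F': "inner (fst F') v = Re (c v)" "inner (snd F') v = Im (c v)" if "v \<in> Basis" for v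
      using that by (simp_all add: F'_def)
    have d: "(component F v has_derivative (*) (c v)) (at z)" if "v \<in> Basis" for v
      using holomorphic_derivI[OF hol[rule_format, OF that] assms z, of UNIV]
      by (simp add: has_field_derivative_def c_def)
    have "((\<lambda>z. (fst (F z), snd (F z))) has_derivative (\<lambda>h. (fst (cx_scale h F'), snd (cx_scale h F')))) (at z)"
    proof (intro has_derivative_Pair)
      show "((\<lambda>z. fst (F z)) has_derivative (\<lambda>h. fst (cx_scale h F'))) (at z)"
      proof (rule iffD2[OF has_derivative_componentwise_within], rule ballI)
        fix v :: 'a assume v: "v \<in> Basis"
        have "((\<lambda>z. Re (component F v z)) has_derivative (\<lambda>h. Re (c v * h))) (at z)"
          by (intro has_derivative_Re d[OF v])
        then show "((\<lambda>z. inner (fst (F z)) v) has_derivative (\<lambda>h. inner (fst (cx_scale h F')) v)) (at z)"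
          by (simp add: component_def cx_scale_def case_prod_unfold inner_diff_left F'[OF v] mult.commute)
      qed
      show "((\<lambda>z. snd (F z)) has_derivative (\<lambda>h. snd (cx_scale h F'))) (at z)"
      proof (rule iffD2[OF has_derivative_componentwise_within], rule ballI)
        fix v :: 'a assume v: "v \<in> Basis"
        have "((\<lambda>z. Im (component F v z)) has_derivative (\<lambda>h. Im (c v * h))) (at z)"
          by (intro has_derivative_Im d[OF v])
        then show "((\<lambda>z. inner (snd (F z)) v) has_derivative (\<lambda>h. inner (snd (cx_scale h F')) v)) (at z)"
          by (simp add: component_def cx_scale_def case_prod_unfold inner_add_left F'[OF v] mult.commute)
      qed
    qed
    then show "\<exists>F'. (F has_derivative (\<lambda>h. cx_scale h F')) (at z)"
      by (intro exI[of _ F']) simp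
  qed
qed

lemma component_holomorphic:
  assumes "open D" "stem_holomorphic D F"
  shows "component F v holomorphic_on D"
proof -
  have "component F v = (\<lambda>z. \<Sum>b\<in>Basis. of_real (inner v b) * component F b z)"
    by (rule ext) (rule component_expand)
  moreover have "(\<lambda>z. \<Sum>b\<in>Basis. of_real (inner v b) * component F b z) holomorphic_on D"
    using assms(2) unfolding stem_holomorphic_iff[OF assms(1)] by (intro holomorphic_intros) auto
  ultimately show ?thesis by simp
qed

text \<open>Needed later for the directions \<open>1\<close> and \<open>I\<close>, which are not
  assumed to be basis vectors.\<close>

lemma power_dvd_component:
  assumes "\<forall>b\<in>Basis. power_dvd D z k (component F b)"
  shows "power_dvd D z k (component F v)"
proof -
  have "component F v = (\<lambda>z. \<Sum>b\<in>Basis. of_real (inner v b) * component F b z)"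
    by (rule ext) (rule component_expand)
  then show ?thesis using assms by (auto intro!: power_dvd_sum power_dvd_cmult)
qed

section \<open>Division by characteristic polynomials\<close>

text \<open>This is the stem of the characteristic polynomial of \<open>slice_point a J\<close>, for
  any imaginary unit \<open>J\<close>.\<close>

definition sphere_poly :: "complex \<Rightarrow> complex \<Rightarrow> complex" where
  "sphere_poly a z = (z - a) * (z - cnj a)"

lemma sphere_poly_cnj: "sphere_poly a (cnj z) = cnj (sphere_poly a z)"
  by (simp add: sphere_poly_def mult.commute)

text \<open>Each of the two cofactors yields a formula for the quotient that is holomorphic except
  at the other point. The formulas agree off both points, so they glue.\<close>

lemma power_dvd_two_points:
  assumes D: "open D" and ab: "a \<noteq> b" and "power_dvd D a m f" "power_dvd D b m f"
  obtains K where "K holomorphic_on D" "\<And>w. w \<in> D \<Longrightarrow> f w = ((w - a) * (w - b)) ^ m * K w"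
proof -
  obtain g where g: "g holomorphic_on D" "\<And>w. w \<in> D \<Longrightarrow> f w = (w - a) ^ m * g w"
    using assms(3) by (auto simp: power_dvd_def)
  obtain q where q: "q holomorphic_on D" "\<And>w. w \<in> D \<Longrightarrow> f w = (w - b) ^ m * q w"
    using assms(4) by (auto simp: power_dvd_def)
  define K where "K w = (if w = b then q w / (w - a) ^ m else g w / (w - b) ^ m)" for w
  have K: "K w = q w / (w - a) ^ m" if "w \<in> D" "w \<noteq> a" for w
    using g(2)[OF that(1)] q(2)[OF that(1)] that by (auto simp: K_def field_simps)
  show ?thesis
  proof
    have "(\<lambda>w. q w / (w - a) ^ m) holomorphic_on (D - {a})"
      using q(1) by (intro holomorphic_intros) (auto intro: holomorphic_on_subset)
    then have 1: "K holomorphic_on (D - {a})" by (rule holomorphic_transform) (simp add: K)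
    have "(\<lambda>w. g w / (w - b) ^ m) holomorphic_on (D - {b})"
      using g(1) by (intro holomorphic_intros) (auto intro: holomorphic_on_subset)
    then have 2: "K holomorphic_on (D - {b})" by (rule holomorphic_transform) (simp add: K_def)
    have "K holomorphic_on ((D - {a}) \<union> (D - {b}))"
      using 1 2 D by (intro holomorphic_on_Un) auto
    moreover have "(D - {a}) \<union> (D - {b}) = D" using ab by auto
    ultimately show "K holomorphic_on D" by simp
    show "f w = ((w - a) * (w - b)) ^ m * K w" if "w \<in> D" for w
      using g(2)[OF that] q(2)[OF that] ab by (auto simp: K_def power_mult_distrib)
  qed
qed

text \<open>Symmetry under conjugation copies the divisibility from \<open>a\<close> to
  \<open>cnj a\<close>. The quotient inherits the symmetry away from these two points, and at them
  by continuity.\<close>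

lemma real_sphere_quotient:
  assumes D: "open D" "cnj ` D = D" and a: "Im a \<noteq> 0" and dvd: "power_dvd D a m f"
    and real: "\<And>z. z \<in> D \<Longrightarrow> f (cnj z) = cnj (f z)"
  obtains K where "K holomorphic_on D" "\<And>z. z \<in> D \<Longrightarrow> K (cnj z) = cnj (K z)"
    "\<And>z. z \<in> D \<Longrightarrow> f z = sphere_poly a z ^ m * K z"
proof -
  have "power_dvd D (cnj a) m (reflect f)" using power_dvd_reflect[OF D dvd] .
  moreover have "reflect f w = f w" if "w \<in> D" for w
    using real[OF that] by (simp add: reflect_def)
  ultimately have dvd': "power_dvd D (cnj a) m f" using power_dvd_cong by blast
  have "a \<noteq> cnj a" using a by (simp add: complex_eq_iff)
  then obtain K where K: "K holomorphic_on D" "\<And>w. w \<in> D \<Longrightarrow> f w = sphere_poly a w ^ m * K w"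
    using power_dvd_two_points[OF D(1) _ dvd dvd'] unfolding sphere_poly_def by metis
  have "reflect K z = K z" if z: "z \<in> D" for z
  proof (rule eq_by_continuity[OF D(1) z _ K(1)])
    show "reflect K holomorphic_on D" using holomorphic_on_reflect[OF D(1)] K(1) D(2) by simp
    have "\<forall>\<^sub>F w in at z. w \<noteq> a" "\<forall>\<^sub>F w in at z. w \<noteq> cnj a"
      by (rule eventually_neq_at_within)+
    then show "\<forall>\<^sub>F w in at z. reflect K w = K w"
      using eventually_in_punctured_open[OF D(1) z]
    proof eventually_elim
      case (elim w)
      have "cnj w \<in> D" using elim D by (simp add: cnj_mem_iff)
      then have "f (cnj w) = cnj (sphere_poly a w) ^ m * K (cnj w)"
        using K(2) by (simp add: sphere_poly_cnj)
      then have "cnj (f w) = cnj (sphere_poly a w ^ m) * K (cnj w)"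
        using real[of w] elim by simp
      then have "f w = sphere_poly a w ^ m * reflect K w"
        unfolding reflect_def by (metis complex_cnj_cnj complex_cnj_mult)
      moreover have "sphere_poly a w \<noteq> 0" using elim by (simp add: sphere_poly_def)
      ultimately show ?case using K(2)[of w] elim by simp
    qed
  qed
  then have "K (cnj z) = cnj (K z)" if "z \<in> D" for z
    using that by (metis complex_cnj_cnj reflect_def)
  with K show ?thesis using that by blast
qed

text \<open>Reduces division by a power of the characteristic polynomial to orders of the
  coordinates at the single point \<open>a\<close>; the conjugate point is taken care of by the stem
  condition.\<close>

lemma stem_sphere_poly_dvd_iff:
  fixes F :: "complex \<Rightarrow> 'a::alt_star_algebra complexified"
  assumes D: "open D" "cnj ` D = D" and F: "stem_function D F" and a: "Im a \<noteq> 0"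
  shows "(\<exists>K. stem_function D K \<and> stem_holomorphic D K \<and>
            (\<forall>z\<in>D. F z = cx_scale (sphere_poly a z ^ m) (K z))) \<longleftrightarrow>
         (\<forall>v\<in>Basis. power_dvd D a m (component F v))"
proof
  assume "\<exists>K. stem_function D K \<and> stem_holomorphic D K \<and>
            (\<forall>z\<in>D. F z = cx_scale (sphere_poly a z ^ m) (K z))"
  then obtain K where K: "stem_holomorphic D K" "\<And>z. z \<in> D \<Longrightarrow> F z = cx_scale (sphere_poly a z ^ m) (K z)"
    by blast
  have "component F v z = (z - a) ^ m * ((z - cnj a) ^ m * component K v z)" if "z \<in> D" for v z
  proof -
    have "component F v z = component (\<lambda>z. cx_scale (sphere_poly a z ^ m) (K z)) v z"
      using K(2)[OF that] by (simp add: component_def)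
    then show ?thesis by (simp add: component_scaleC sphere_poly_def power_mult_distrib)
  qed
  moreover have "(\<lambda>z. (z - cnj a) ^ m * component K v z) holomorphic_on D" for v
    by (intro holomorphic_intros component_holomorphic D K)
  ultimately show "\<forall>v\<in>Basis. power_dvd D a m (component F v)"
    unfolding power_dvd_def by blast
next
  assume dvd: "\<forall>v\<in>Basis. power_dvd D a m (component F v)"
  have "\<exists>k. k holomorphic_on D \<and> (\<forall>z\<in>D. k (cnj z) = cnj (k z)) \<and>
      (\<forall>z\<in>D. component F v z = sphere_poly a z ^ m * k z)" if v: "v \<in> Basis" for v
    using real_sphere_quotient[OF D a, of m "component F v"] dvd v F unfolding stem_function_iff by metis
  then obtain k where k: "\<And>v. v \<in> Basis \<Longrightarrow> k v holomorphic_on D"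
    "\<And>v z. v \<in> Basis \<Longrightarrow> z \<in> D \<Longrightarrow> k v (cnj z) = cnj (k v z)"
    "\<And>v z. v \<in> Basis \<Longrightarrow> z \<in> D \<Longrightarrow> component F v z = sphere_poly a z ^ m * k v z"
    by metis
  define K :: "complex \<Rightarrow> 'a complexified" where
    "K z = (\<Sum>v\<in>Basis. Re (k v z) *\<^sub>R v, \<Sum>v\<in>Basis. Im (k v z) *\<^sub>R v)" for z
  have K: "component K v = k v" if "v \<in> Basis" for v
    using that by (simp add: component_def K_def fun_eq_iff)
  have "stem_function D K" "stem_holomorphic D K"
    using k by (simp_all add: K stem_function_iff stem_holomorphic_iff[OF D(1)])
  moreover have "F z = cx_scale (sphere_poly a z ^ m) (K z)" if "z \<in> D" for z
    by (rule complexified_eqI[of F z "\<lambda>z. cx_scale (sphere_poly a z ^ m) (K z)"])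
      (simp add: component_scaleC K k(3) that)
  ultimately show "\<exists>K. stem_function D K \<and> stem_holomorphic D K \<and>
            (\<forall>z\<in>D. F z = cx_scale (sphere_poly a z ^ m) (K z))" by blast
qed

section \<open>Slice functions with given stem\<close>

lemma imag_units_nonempty: "\<exists>I::'a::alt_star_algebra. I \<in> imag_units"
  using ex_imag_unit by (auto simp: imag_units_def)

lemma circularizationE:
  assumes "x \<in> circularization D"
  obtains z I where "z \<in> D" "I \<in> imag_units" "x = slice_point z I"
  using assms by (auto simp: circularization_def)

lemma slice_point_in_circularization:
  "z \<in> D \<Longrightarrow> I \<in> imag_units \<Longrightarrow> slice_point z I \<in> circularization D"
  by (auto simp: circularization_def)

lemma nonreal_slice_point_iff:
  fixes I :: "'a::alt_star_algebra"
  assumes "I \<in> imag_units"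
  shows "nonreal (slice_point z I) \<longleftrightarrow> Im z \<noteq> 0"
proof -
  have "slice_point z I \<in> range (\<lambda>r. r *\<^sub>R 1) \<longleftrightarrow> Im z = 0"
  proof
    assume "slice_point z I \<in> range (\<lambda>r. r *\<^sub>R 1)"
    then obtain r where "slice_point z I = slice_point (of_real r) I"
      by (auto simp: slice_point_def)
    from slice_point_eq[OF assms assms this] show "Im z = 0"
      by (auto simp: complex_eq_iff)
  qed (auto simp: slice_point_def)
  then show ?thesis by (simp add: nonreal_def)
qed

lemma slice_fun_eq_iff:
  fixes F G :: "complex \<Rightarrow> 'a::alt_star_algebra complexified"
  assumes F: "stem_function D F" and G: "stem_function D G"
  shows "(\<forall>x\<in>circularization D. slice_fun D F x = slice_fun D G x) \<longleftrightarrow> (\<forall>z\<in>D. F z = G z)"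
proof
  assume "\<forall>z\<in>D. F z = G z"
  then have "slice_fun D F = slice_fun D G" by (intro slice_fun_cong) auto
  then show "\<forall>x\<in>circularization D. slice_fun D F x = slice_fun D G x" by simp
qed (use stem_unique[OF F G] in blast)

lemma stem_function_complex:
  assumes "\<And>z. z \<in> D \<Longrightarrow> p (cnj z) = cnj (p z)"
  shows "stem_function D (\<lambda>z. (Re (p z) *\<^sub>R 1, Im (p z) *\<^sub>R 1))"
  using assms by (simp add: stem_function_def cx_bar_def)

lemma stem_function_scale:
  assumes "\<And>z. z \<in> D \<Longrightarrow> p (cnj z) = cnj (p z)" "stem_function D K"
  shows "stem_function D (\<lambda>z. cx_scale (p z) (K z))"
  using assms by (simp add: stem_function_def cx_bar_def cx_scale_def case_prod_unfold)

lemma cx_mult_complex: "cx_mult (Re w *\<^sub>R 1, Im w *\<^sub>R 1) X = cx_scale w X"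
  by (simp add: cx_mult_def cx_scale_def case_prod_unfold alt_bilinear)

lemma cx_scale_complex: "cx_scale w (Re p *\<^sub>R 1, Im p *\<^sub>R 1) = (Re (w * p) *\<^sub>R 1, Im (w * p) *\<^sub>R 1)"
  by (simp add: cx_scale_def algebra_simps scaleR_left_diff_distrib scaleR_left_distrib)

lemma complexified_norm_cx_bar: "complexified_norm (cx_bar X) = cnj (complexified_norm X)"
  by (simp add: complexified_norm_def cx_bar_def case_prod_unfold complex_eq_iff)

lemma complexified_norm_stem:
  assumes "stem_function D F" "z \<in> D"
  shows "complexified_norm (F (cnj z)) = cnj (complexified_norm (F z))"
  using assms by (simp add: stem_function_def complexified_norm_cx_bar)

section \<open>Normal functions, zeros on spheres and characteristic polynomials in terms of
  stems\<close>

lemma stem_of_eq: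
  fixes F :: "complex \<Rightarrow> 'a::alt_star_algebra complexified"
  assumes "cnj ` D = D" "stem_function D F" "\<forall>x\<in>circularization D. f x = slice_fun D F x" "z \<in> D"
  shows "stem_of D f z = F z"
  using stem_of_slice_fun[OF assms(1-3)] assms(4) by simp

lemma normal_fun_eq:
  fixes F :: "complex \<Rightarrow> 'a::alt_star_algebra complexified"
  assumes D: "cnj ` D = D" and F: "stem_function D F"
    and f: "\<forall>x\<in>circularization D. f x = slice_fun D F x"
  shows "normal_fun D f = slice_fun D (\<lambda>z. (Re (complexified_norm (F z)) *\<^sub>R 1, Im (complexified_norm (F z)) *\<^sub>R 1))"
proof -
  have stem: "stem_of D f z = F z" if "z \<in> D" for z
    using stem_of_eq[OF D F f that] .
  have "slice_cjg D f = slice_fun D (\<lambda>z. cx_cjg (F z))"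
    unfolding slice_cjg_def using stem by (intro slice_fun_cong) simp
  moreover have "stem_function D (\<lambda>z. cx_cjg (F z))"
    using F by (auto simp: stem_function_def cx_cjg_def cx_bar_def case_prod_unfold cjg_minus)
  ultimately have "stem_of D (slice_cjg D f) z = cx_cjg (F z)" if "z \<in> D" for z
    using stem_of_eq[OF D, of "\<lambda>z. cx_cjg (F z)" "slice_cjg D f"] that by simp
  then show ?thesis
    unfolding normal_fun_def star_prod_def using stem
    by (intro slice_fun_cong) (simp add: cx_mult_cx_cjg)
qed

text \<open>The values at \<open>I\<close> and \<open>- I\<close> already determine both parts of
  \<open>F z\<close>. Conversely a point of the sphere may be written with \<open>z\<close> or with
  \<open>cnj z\<close>, and \<open>F\<close> vanishes at both.\<close>

lemma zero_on_sphere_iff: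
  fixes F :: "complex \<Rightarrow> 'a::alt_star_algebra complexified"
  assumes D: "cnj ` D = D" and F: "stem_function D F"
    and f: "\<forall>x\<in>circularization D. f x = slice_fun D F x"
    and z: "z \<in> D" and I: "I \<in> imag_units"
  shows "(\<forall>x\<in>sphere_of (slice_point z I). f x = 0) \<longleftrightarrow> F z = 0"
proof
  have val: "f (slice_point w J) = fst (F w) + J * snd (F w)" if "w \<in> D" "J \<in> imag_units" for w J
    using f slice_point_in_circularization[OF that] slice_fun_slice_point[OF F that] by simp
  {
    assume *: "\<forall>x\<in>sphere_of (slice_point z I). f x = 0"
    have "slice_point z J \<in> sphere_of (slice_point z I)" if "J \<in> imag_units" for J
      using that I by (auto simp: sphere_of_def)
    then have **: "fst (F z) + J * snd (F z) = 0" if "J \<in> imag_units" for J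
      using * val[OF z that] that by simp
    have 1: "fst (F z) + I * snd (F z) = 0" using **[OF I] .
    have 2: "fst (F z) - I * snd (F z) = 0"
      using **[of "- I"] I by (simp add: imag_units_minus alt_bilinear)
    have "2 *\<^sub>R fst (F z) = 0" using 1 2 by (metis add.right_neutral add_diff_eq diff_add_cancel scaleR_2 add_diff_cancel_right')
    then have a: "fst (F z) = 0" by simp
    then have "I * (I * snd (F z)) = 0" using 1 by (simp add: alt_bilinear)
    moreover have "I * (I * snd (F z)) = - snd (F z)"
      using I by (simp add: alt_left imag_units_def alt_bilinear)
    ultimately show "F z = 0" using a by (simp add: prod_eq_iff)
  }
  assume F0: "F z = 0"
  show "\<forall>x\<in>sphere_of (slice_point z I). f x = 0"
  proof
    fix x assume "x \<in> sphere_of (slice_point z I)"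
    then obtain w J I' where x: "x = slice_point w J" "J \<in> imag_units" "I' \<in> imag_units"
      "slice_point z I = slice_point w I'" by (auto simp: sphere_of_def)
    have "w = z \<or> w = cnj z" using slice_point_eq[OF I x(3,4)] by auto
    moreover have "F (cnj z) = 0" using F z F0 by (simp add: stem_function_def cx_bar_def zero_prod_def)
    ultimately have "w \<in> D" "F w = 0" using z D F0 by (auto simp: cnj_mem_iff)
    then show "f x = 0" using val x(2) unfolding x(1) by (simp add: alt_zero_right)
  qed
qed

lemma char_poly_of_slice_point:
  fixes I J :: "'a::alt_star_algebra"
  assumes I: "I \<in> imag_units" and J: "J \<in> imag_units"
  shows "char_poly_of (slice_point a J) (slice_point z I) =
    Re (sphere_poly a z) *\<^sub>R 1 + I * (Im (sphere_poly a z) *\<^sub>R 1)"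
proof -
  have tr: "slice_point a J + cjg (slice_point a J) = (2 * Re a) *\<^sub>R 1"
    using imag_unitD[OF J] by (simp add: cjg_trace slice_point_def inner_add_right inner_one_one)
  have "(norm (slice_point a J))\<^sup>2 = (Re a)\<^sup>2 + (Im a)\<^sup>2"
    using imag_unitD[OF J] norm_one_alt[where 'a='a] unfolding slice_point_def power2_norm_eq_inner
    by (simp add: inner_add_left inner_add_right inner_one_one inner_commute power2_eq_square norm_eq_1)
  then have nm: "slice_point a J * cjg (slice_point a J) = ((Re a)\<^sup>2 + (Im a)\<^sup>2) *\<^sub>R 1"
    by (simp add: cjg_norm)
  have II: "I * I = - 1" using I by (simp add: imag_units_def)
  have "char_poly_of (slice_point a J) (slice_point z I) =
     ((Re z)\<^sup>2 - (Im z)\<^sup>2 - 2 * Re a * Re z + (Re a)\<^sup>2 + (Im a)\<^sup>2) *\<^sub>R 1 + (2 * Re z * Im z - 2 * Re a * Im z) *\<^sub>R I"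
    unfolding char_poly_of_def tr nm unfolding slice_point_def
    by (simp add: alt_bilinear II scaleR_left_diff_distrib scaleR_left_distrib scaleR_right_distrib
        power2_eq_square algebra_simps flip: scaleR_2)
  also have "(Re z)\<^sup>2 - (Im z)\<^sup>2 - 2 * Re a * Re z + (Re a)\<^sup>2 + (Im a)\<^sup>2 = Re (sphere_poly a z)"
    by (simp add: sphere_poly_def power2_eq_square algebra_simps)
  also have "2 * Re z * Im z - 2 * Re a * Im z = Im (sphere_poly a z)"
    by (simp add: sphere_poly_def algebra_simps)
  finally show ?thesis by (simp add: alt_bilinear)
qed

lemma star_power_char_poly:
  fixes J :: "'a::alt_star_algebra"
  assumes D: "cnj ` D = D" and J: "J \<in> imag_units"
  shows "\<forall>x\<in>circularization D. star_power D (char_poly_of (slice_point a J)) m x =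
    slice_fun D (\<lambda>z. (Re (sphere_poly a z ^ m) *\<^sub>R 1, Im (sphere_poly a z ^ m) *\<^sub>R 1)) x"
proof (induction m)
  case 0
  show ?case
  proof
    fix x :: 'a assume "x \<in> circularization D"
    then obtain z I where "z \<in> D" "I \<in> imag_units" "x = slice_point z I" by (rule circularizationE)
    then show "star_power D (char_poly_of (slice_point a J)) 0 x =
        slice_fun D (\<lambda>z. (Re (sphere_poly a z ^ 0) *\<^sub>R 1, Im (sphere_poly a z ^ 0) *\<^sub>R 1)) x"
      by (simp add: slice_fun_slice_point stem_function_def cx_bar_def alt_zero_right)
  qed
next
  case (Suc m)
  have stem: "stem_function D (\<lambda>z. (Re (sphere_poly a z ^ k) *\<^sub>R 1, Im (sphere_poly a z ^ k) *\<^sub>R (1::'a)))" for k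
    by (rule stem_function_complex) (simp add: sphere_poly_cnj)
  have 1: "\<forall>x\<in>circularization D. char_poly_of (slice_point a J) x =
    slice_fun D (\<lambda>z. (Re (sphere_poly a z ^ 1) *\<^sub>R 1, Im (sphere_poly a z ^ 1) *\<^sub>R 1)) x"
  proof
    fix x :: 'a assume "x \<in> circularization D"
    then obtain z I where "z \<in> D" "I \<in> imag_units" "x = slice_point z I" by (rule circularizationE)
    then show "char_poly_of (slice_point a J) x =
        slice_fun D (\<lambda>z. (Re (sphere_poly a z ^ 1) *\<^sub>R 1, Im (sphere_poly a z ^ 1) *\<^sub>R 1)) x"
      using slice_fun_slice_point[OF stem[of 1], of z I] by (simp add: char_poly_of_slice_point[OF _ J])
  qed
  have "star_power D (char_poly_of (slice_point a J)) (Suc m) =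
     slice_fun D (\<lambda>z. (Re (sphere_poly a z ^ Suc m) *\<^sub>R 1, Im (sphere_poly a z ^ Suc m) *\<^sub>R 1))"
    unfolding star_power.simps star_prod_def
  proof (rule slice_fun_cong)
    fix z assume "z \<in> D"
    note e = stem_of_eq[OF D stem[of 1] 1 this] stem_of_eq[OF D stem[of m] Suc.IH this]
    show "cx_mult (stem_of D (char_poly_of (slice_point a J)) z)
        (stem_of D (star_power D (char_poly_of (slice_point a J)) m) z) =
      (Re (sphere_poly a z ^ Suc m) *\<^sub>R 1, Im (sphere_poly a z ^ Suc m) *\<^sub>R 1)"
      unfolding e cx_mult_complex cx_scale_complex by simp
  qed
  then show ?case by simp
qed

lemma star_power_char_poly_dvd_iff:
  fixes F :: "complex \<Rightarrow> 'a::alt_star_algebra complexified"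
  assumes D: "open D" "cnj ` D = D" and F: "stem_function D F"
    and f: "\<forall>x\<in>circularization D. f x = slice_fun D F x"
    and a: "Im a \<noteq> 0" and J: "J \<in> imag_units"
  shows "(\<exists>g. slice_regular D g \<and>
      (\<forall>x\<in>circularization D. f x = star_prod D (star_power D (char_poly_of (slice_point a J)) m) g x)) \<longleftrightarrow>
    (\<forall>v\<in>Basis. power_dvd D a m (component F v))" (is "(\<exists>g. ?P g) \<longleftrightarrow> _")
proof -
  let ?p = "\<lambda>z. sphere_poly a z ^ m"
  have preal: "?p (cnj z) = cnj (?p z)" for z by (simp add: sphere_poly_cnj)
  have stem: "stem_function D (\<lambda>z. (Re (?p z) *\<^sub>R 1, Im (?p z) *\<^sub>R (1::'a)))"
    by (rule stem_function_complex) (simp add: sphere_poly_cnj)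
  note pow = stem_of_eq[OF D(2) stem star_power_char_poly[OF D(2) J]]
  have prod: "star_prod D (star_power D (char_poly_of (slice_point a J)) m) g =
      slice_fun D (\<lambda>z. cx_scale (?p z) (K z))"
    if K: "stem_function D K" "\<forall>x\<in>circularization D. g x = slice_fun D K x" for g K
    unfolding star_prod_def
    by (intro slice_fun_cong) (simp only: pow stem_of_eq[OF D(2) K] cx_mult_complex)
  \<comment> \<open>Stems are unique, so an equation between slice functions is one between their
    stems.\<close>
  have key: "(\<forall>x\<in>circularization D. f x = star_prod D (star_power D (char_poly_of (slice_point a J)) m) g x) \<longleftrightarrow>
      (\<forall>z\<in>D. F z = cx_scale (?p z) (K z))"
    if K: "stem_function D K" "\<forall>x\<in>circularization D. g x = slice_fun D K x" for g K
    using f slice_fun_eq_iff[OF F stem_function_scale[of D ?p, OF preal K(1)]] unfolding prod[OF K] by simp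
  have "(\<exists>g. ?P g) \<longleftrightarrow> (\<exists>K. stem_function D K \<and> stem_holomorphic D K \<and> (\<forall>z\<in>D. F z = cx_scale (?p z) (K z)))"
  proof
    assume "\<exists>g. ?P g"
    then show "\<exists>K. stem_function D K \<and> stem_holomorphic D K \<and> (\<forall>z\<in>D. F z = cx_scale (?p z) (K z))"
      unfolding slice_regular_def using key by blast
  next
    assume "\<exists>K. stem_function D K \<and> stem_holomorphic D K \<and> (\<forall>z\<in>D. F z = cx_scale (?p z) (K z))"
    then obtain K where "stem_function D K" "stem_holomorphic D K" "\<forall>z\<in>D. F z = cx_scale (?p z) (K z)"
      by blast
    then have "?P (slice_fun D K)" using key[of K "slice_fun D K"] unfolding slice_regular_def by blast
    then show "\<exists>g. ?P g" by blast
  qed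
  then show ?thesis using stem_sphere_poly_dvd_iff[OF D F a] by simp
qed

text \<open>A spherical multiplicity is indexed by a point \<open>q\<close> of which only the sphere
  is known; this recovers coordinates of \<open>q\<close> in \<open>D\<close>.\<close>

lemma sphere_of_eqD:
  fixes I :: "'a::alt_star_algebra"
  assumes D: "cnj ` D = D" and z: "z \<in> D" "Im z \<noteq> 0" and I: "I \<in> imag_units"
    and eq: "sphere_of q = sphere_of (slice_point z I)"
  obtains w J where "w \<in> D" "Im w \<noteq> 0" "J \<in> imag_units" "q = slice_point w J"
proof -
  have "slice_point z I \<in> sphere_of q" using I unfolding eq by (auto simp: sphere_of_def)
  then obtain w J J' where w: "slice_point z I = slice_point w J" "J \<in> imag_units" "J' \<in> imag_units"
    "q = slice_point w J'" by (auto simp: sphere_of_def)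
  have "w = z \<or> w = cnj z" using slice_point_eq[OF I w(2,1)] by auto
  then show ?thesis using that[of w J'] w z D by (auto simp: cnj_mem_iff)
qed

section \<open>The semi-model\<close>

text \<open>\<open>D\<close> is disconnected if it misses the real axis, so the identity theorem is
  applied on the upper half. A point with \<open>h \<noteq> 0\<close> is brought there by reflection
  or a small upward shift, and the conclusion is carried back to an arbitrary \<open>z\<close> in
  the same way.\<close>

lemma eventually_nonzero_of_reflection_symmetric:
  assumes D: "open D" "cnj ` D = D" and conn: "connected (D \<inter> {z. Im z > 0})"
    and h: "h holomorphic_on D" and real: "\<And>z. z \<in> D \<Longrightarrow> h (cnj z) = cnj (h z)"
    and nz: "\<zeta> \<in> D" "h \<zeta> \<noteq> 0" and z: "z \<in> D"
  shows "\<forall>\<^sub>F w in at z. h w \<noteq> 0"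
proof -
  define H where "H = D \<inter> {z. Im z > 0}"
  have H: "open H" unfolding H_def by (intro open_Int D open_halfspace_Im_gt)
  have hH: "h holomorphic_on H" using h by (rule holomorphic_on_subset) (auto simp: H_def)
  have near: "\<exists>w\<in>H. h w \<noteq> 0" if x: "x \<in> D" "open U" "x \<in> U" "U \<subseteq> D" "\<And>w. w \<in> U \<Longrightarrow> h w \<noteq> 0" for x U
  proof (cases "Im x \<ge> 0")
    case True
    obtain e where e: "e > 0" "ball x e \<subseteq> U" using x by (meson openE)
    have "x + Complex 0 (e/2) \<in> ball x e" using e(1) by (simp add: dist_norm complex_norm)
    then have w: "x + Complex 0 (e/2) \<in> U" using e by blast
    then have "x + Complex 0 (e/2) \<in> H" using x(4) True e(1) by (auto simp: H_def)
    with w x(5) show ?thesis by blast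
  next
    case False
    have "cnj x \<in> H" using False x D by (simp add: H_def cnj_mem_iff)
    moreover have "h (cnj x) \<noteq> 0" using real[OF x(1)] x(5)[OF x(3)] by simp
    ultimately show ?thesis by blast
  qed
  have "\<forall>\<^sub>F w in nhds \<zeta>. h w \<noteq> 0 \<and> w \<in> D"
    using tendsto_imp_eventually_ne[OF holomorphic_tendsto[OF D(1) nz(1) h] nz(2)] nz(2)
      eventually_nhds_in_open[OF D(1) nz(1)]
    by (intro eventually_conj) (simp_all add: eventually_nhds_conv_at)
  then obtain U where U: "open U" "\<zeta> \<in> U" "\<And>w. w \<in> U \<Longrightarrow> h w \<noteq> 0 \<and> w \<in> D"
    unfolding eventually_nhds by blast
  then obtain b where b: "b \<in> H" "h b \<noteq> 0"
    using near[OF nz(1) U(1,2)] by blast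
  have evH: "\<forall>\<^sub>F w in at y. h w \<noteq> 0 \<and> w \<in> H" if "y \<in> H" for y
    using non_zero_neighbour_alt[OF hH H _ that b] conn unfolding H_def by blast
  obtain e where e: "e > 0" "ball z e \<subseteq> D" using D z by (meson openE)
  have "\<exists>w\<in>ball z e. h w \<noteq> 0"
  proof -
    define y where "y = (if Im z \<ge> 0 then z + Complex 0 (e/2) else z)"
    have y: "y \<in> ball z e" "Im y \<noteq> 0"
      using e(1) by (auto simp: y_def dist_norm complex_norm)
    then have yD: "y \<in> D" using e by blast
    show ?thesis
    proof (cases "Im y > 0")
      case True
      then have "\<forall>\<^sub>F w in at y. h w \<noteq> 0 \<and> w \<in> H" using evH[of y] yD by (simp add: H_def)
      then have "\<forall>\<^sub>F w in at y. h w \<noteq> 0 \<and> w \<in> ball z e"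
        using eventually_in_punctured_open[OF open_ball y(1)] by eventually_elim auto
      then obtain w where "h w \<noteq> 0 \<and> w \<in> ball z e"
        using eventually_happens'[OF at_neq_bot] by blast
      then show ?thesis by blast
    next
      case False
      then have zy: "y = z" "Im z < 0" using y(2) e(1) by (auto simp: y_def split: if_splits)
      then have "cnj z \<in> H" using z D by (simp add: H_def cnj_mem_iff)
      have "open (cnj ` ball z e)"
        by (simp add: image_cnj_conv_vimage_cnj open_vimage continuous_on_cnj continuous_on_id)
      moreover have "cnj z \<in> cnj ` ball z e" using e(1) by simp
      ultimately have "\<forall>\<^sub>F w in at (cnj z). h w \<noteq> 0 \<and> w \<in> cnj ` ball z e"
        using evH[OF \<open>cnj z \<in> H\<close>] eventually_in_punctured_open[of "cnj ` ball z e" "cnj z"]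
        by (auto elim: eventually_elim2)
      then obtain w where w: "h w \<noteq> 0" "w \<in> cnj ` ball z e"
        using eventually_happens'[OF at_neq_bot] by blast
      then obtain v where v: "v \<in> ball z e" "w = cnj v" by blast
      then have "h v \<noteq> 0" using real[of v] e(2) w(1) by auto
      with v show ?thesis by blast
    qed
  qed
  then obtain w where w: "w \<in> ball z e" "h w \<noteq> 0" by blast
  have "\<forall>\<^sub>F w in at z. h w \<noteq> 0 \<and> w \<in> ball z e"
    using non_zero_neighbour_alt[OF holomorphic_on_subset[OF h e(2)] open_ball connected_ball _ w] e(1) by simp
  then show ?thesis by (rule eventually_mono) blast
qed

lemma complexified_norm_holomorphic:
  assumes "open D" "stem_holomorphic D F"
  shows "(\<lambda>z. complexified_norm (F z)) holomorphic_on D"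
  unfolding sum_component_power2[symmetric]
  by (intro holomorphic_intros component_holomorphic assms)

text \<open>Extracting the common power \<open>m\<close> from the coordinates extracts
  \<open>2 * m\<close> from the sum of their squares. At a real point the cofactors take real
  values, not all zero, so their squares cannot cancel and \<open>2 * m\<close> is the exact
  order.\<close>

lemma stem_common_order:
  fixes F :: "complex \<Rightarrow> 'a::alt_star_algebra complexified"
  assumes D: "open D" "cnj ` D = D" and F: "stem_function D F" "stem_holomorphic D F"
    and ev: "\<forall>\<^sub>F w in at z. complexified_norm (F w) \<noteq> 0" and z: "z \<in> D"
  obtains m n where "has_order D z n (\<lambda>z. complexified_norm (F z))"
    "\<And>k. (\<forall>v\<in>Basis. power_dvd D z k (component F v)) \<longleftrightarrow> k \<le> m"
    "2 * m \<le> n" "Im z = 0 \<Longrightarrow> n = 2 * m"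
proof -
  let ?h = "\<lambda>z. complexified_norm (F z)"
  obtain n where n: "has_order D z n ?h"
    using ex_has_order[OF D(1) z complexified_norm_holomorphic[OF D(1) F(2)] ev] by blast
  have bound: "2 * k \<le> n" if "\<And>v. v \<in> Basis \<Longrightarrow> power_dvd D z k (component F v)" for k
  proof -
    have "power_dvd D z (2 * k) (\<lambda>w. \<Sum>v\<in>Basis. (component F v w)\<^sup>2)"
      by (intro power_dvd_sum power_dvd_power2 that)
    then show ?thesis
      using power_dvd_le_order[OF D(1) z n] by (simp add: sum_component_power2)
  qed
  obtain m g where g: "\<And>v. v \<in> Basis \<Longrightarrow> g v holomorphic_on D"
    "\<And>v w. v \<in> Basis \<Longrightarrow> w \<in> D \<Longrightarrow> component F v w = (w - z) ^ m * g v w" "\<exists>v\<in>Basis. g v z \<noteq> 0"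
  proof (rule max_common_power[OF D(1), of Basis "component F" z n])
    show "component F v holomorphic_on D" for v by (rule component_holomorphic[OF D(1) F(2)])
    show "k \<le> n" if "\<And>v. v \<in> Basis \<Longrightarrow> power_dvd D z k (component F v)" for k
      using bound[OF that] by linarith
  qed blast
  have dvd: "power_dvd D z m (component F v)" if "v \<in> Basis" for v
    unfolding power_dvd_def using g(1,2)[OF that] by blast
  obtain b where b: "b \<in> Basis" "g b z \<noteq> 0" using g(3) by blast
  have ord: "has_order D z m (component F b)"
    unfolding has_order_def using g(1,2)[OF b(1)] b(2) by blast
  have iff: "(\<forall>v\<in>Basis. power_dvd D z k (component F v)) \<longleftrightarrow> k \<le> m" for k
    using dvd power_dvd_mono power_dvd_le_order[OF D(1) z ord] b(1) by blast
  have "n = 2 * m" if "Im z = 0"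
  proof -
    have cz: "cnj z = z" using that by (simp add: complex_eq_iff)
    have greal: "g v z \<in> \<real>" if v: "v \<in> Basis" for v
    proof -
      have "reflect (g v) z = g v z"
      proof (rule eq_by_continuity[OF D(1) z _ g(1)[OF v]])
        show "reflect (g v) holomorphic_on D"
          using holomorphic_on_reflect[OF D(1)] g(1)[OF v] D(2) by simp
        show "\<forall>\<^sub>F w in at z. reflect (g v) w = g v w"
          using eventually_in_punctured_open[OF D(1) z]
        proof eventually_elim
          case (elim w)
          have "cnj w \<in> D" using elim D by (simp add: cnj_mem_iff)
          have "component F v w = cnj (component F v (cnj w))"
            using F(1) v elim unfolding stem_function_iff by simp
          also have "\<dots> = (w - z) ^ m * reflect (g v) w"
            using g(2)[OF v \<open>cnj w \<in> D\<close>] cz by (simp add: reflect_def)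
          finally show ?case using g(2)[OF v, of w] elim by simp
        qed
      qed
      then show ?thesis using cz by (simp add: reflect_def Reals_cnj_iff)
    qed
    have "(\<Sum>v\<in>Basis. (g v z)\<^sup>2) = of_real (\<Sum>v\<in>Basis. (Re (g v z))\<^sup>2)"
      using greal by (simp add: of_real_Re)
    moreover have "Re (g b z) \<noteq> 0" using b(2) greal[OF b(1)] by (metis of_real_0 of_real_Re)
    then have "(\<Sum>v\<in>Basis. (Re (g v z))\<^sup>2) > 0"
      using b(1) by (intro sum_pos2[of _ b]) auto
    ultimately have nz: "(\<Sum>v\<in>Basis. (g v z)\<^sup>2) \<noteq> 0" by (metis less_irrefl of_real_eq_0_iff)
    have "has_order D z (2 * m) ?h"
      unfolding has_order_def
    proof (intro exI[of _ "\<lambda>w. \<Sum>v\<in>Basis. (g v w)\<^sup>2"] conjI ballI nz)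
      show "(\<lambda>w. \<Sum>v\<in>Basis. (g v w)\<^sup>2) holomorphic_on D" by (intro holomorphic_intros g(1))
      fix w assume "w \<in> D"
      then show "complexified_norm (F w) = (w - z) ^ (2 * m) * (\<Sum>v\<in>Basis. (g v w)\<^sup>2)"
        unfolding sum_component_power2[symmetric] sum_distrib_left
        by (intro sum.cong) (simp_all add: g(2) power_mult_distrib mult.commute[of 2] power_mult)
    qed
    then show ?thesis using has_order_unique[OF D(1) z n] by simp
  qed
  with n iff bound[OF dvd] show ?thesis using that by blast
qed

section \<open>Reading zeros and multiplicities off the stem\<close>

lemma power_dvd_one_iff:
  assumes "open D" "f holomorphic_on D" "z \<in> D"
  shows "power_dvd D z 1 f \<longleftrightarrow> f z = 0"
proof
  assume "f z = 0"
  from factor_out_zero[OF assms(1,2) this] show "power_dvd D z 1 f"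
    unfolding power_dvd_def by (metis power_one_right)
qed (use assms in \<open>auto simp: power_dvd_def\<close>)

text \<open>Exponent 1 governs the spherical zeros. For multiplicities all exponents agree, so the
  two sets whose greatest element is taken are equal and neither maximum has to be computed.\<close>

lemma spherical_data_cong:
  fixes F G :: "complex \<Rightarrow> 'a::alt_star_algebra complexified"
  assumes D: "open D" "cnj ` D = D" and F: "stem_function D F" "stem_holomorphic D F"
    and G: "stem_function D G" "stem_holomorphic D G"
    and f: "\<forall>x\<in>circularization D. f x = slice_fun D F x"
    and g: "\<forall>x\<in>circularization D. g x = slice_fun D G x"
    and dvd: "\<And>z k. z \<in> D \<Longrightarrow> Im z \<noteq> 0 \<Longrightarrow>
      (\<forall>v\<in>Basis. power_dvd D z k (component F v)) \<longleftrightarrow> (\<forall>v\<in>Basis. power_dvd D z k (component G v))"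
  shows "spherical_zeros D g = spherical_zeros D f"
    and "sphere_of q \<in> spherical_zeros D f \<Longrightarrow> spherical_multiplicity D g q = spherical_multiplicity D f q"
proof -
  have one: "(\<forall>v\<in>Basis. power_dvd D z 1 (component K v)) \<longleftrightarrow> K z = 0"
    if "stem_holomorphic D K" "z \<in> D" for K :: "complex \<Rightarrow> 'a complexified" and z
    unfolding component_eq_0_iff[symmetric]
    by (intro ball_cong refl power_dvd_one_iff component_holomorphic D(1) that)
  have zero: "F z = 0 \<longleftrightarrow> G z = 0" if "z \<in> D" "Im z \<noteq> 0" for z
    using dvd[OF that, of 1] unfolding one[OF F(2) that(1)] one[OF G(2) that(1)] .
  have "(\<forall>x\<in>sphere_of q. f x = 0) \<longleftrightarrow> (\<forall>x\<in>sphere_of q. g x = 0)"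
    if q0: "q \<in> circularization D" "nonreal q" for q
  proof -
    obtain z I where q: "z \<in> D" "I \<in> imag_units" "q = slice_point z I"
      using q0(1) by (rule circularizationE)
    then have "Im z \<noteq> 0" using q0(2) by (simp add: nonreal_slice_point_iff)
    then show ?thesis
      using zero_on_sphere_iff[OF D(2) F(1) f q(1,2)] zero_on_sphere_iff[OF D(2) G(1) g q(1,2)] zero q
      by simp
  qed
  then show "spherical_zeros D g = spherical_zeros D f"
    unfolding spherical_zeros_def by blast
  assume "sphere_of q \<in> spherical_zeros D f"
  then obtain q' where q': "q' \<in> circularization D" "nonreal q'" "sphere_of q = sphere_of q'"
    by (auto simp: spherical_zeros_def)
  obtain z I where z: "z \<in> D" "I \<in> imag_units" "q' = slice_point z I"
    using q'(1) by (rule circularizationE)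
  then have "Im z \<noteq> 0" using q'(2) by (simp add: nonreal_slice_point_iff)
  then obtain w J where w: "w \<in> D" "Im w \<noteq> 0" "J \<in> imag_units" "q = slice_point w J"
    using sphere_of_eqD[OF D(2) z(1) _ z(2)] q'(3) z(3) by metis
  show "spherical_multiplicity D g q = spherical_multiplicity D f q"
    by (simp only: spherical_multiplicity_def w(4) star_power_char_poly_dvd_iff[OF D F(1) f w(2,3)]
      star_power_char_poly_dvd_iff[OF D G(1) g w(2,3)] dvd[OF w(1,2)])
qed

text \<open>If \<open>a + J b = 0\<close> with \<open>a, b \<in> \<complex>\<^sub>I\<close> and \<open>b \<noteq> 0\<close>, then \<open>J = - a b\<^sup>-\<^sup>1\<close> lies in \<open>\<complex>\<^sub>I\<close> as well.\<close>

lemma isolated_zero_in_slice: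
  fixes G :: "complex \<Rightarrow> 'a::alt_star_algebra complexified"
  assumes D: "cnj ` D = D" and G: "stem_function D G"
    and g: "\<forall>x\<in>circularization D. g x = slice_fun D G x"
    and I: "I \<in> imag_units" and GI: "\<And>z. z \<in> D \<Longrightarrow> fst (G z) \<in> slice I \<and> snd (G z) \<in> slice I"
    and q: "isolated_nonreal_zero D g q"
  shows "q \<in> slice I"
proof -
  have qs: "q \<in> circularization D" "nonreal q" "{x \<in> sphere_of q. g x = 0} = {q}"
    using q by (auto simp: isolated_nonreal_zero_def)
  obtain z J where z: "z \<in> D" "J \<in> imag_units" "q = slice_point z J"
    using qs(1) by (rule circularizationE)
  have slice: "x \<in> slice I \<longleftrightarrow> (\<exists>r s. x = r *\<^sub>R 1 + s *\<^sub>R I)" for x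
    by (auto simp: slice_def span_insert span_singleton algebra_simps)
  obtain a b where Gz: "G z = (a, b)" by (cases "G z")
  have "g q = 0" using qs(3) by blast
  then have eq: "a + J * b = 0"
    using g qs(1) slice_fun_slice_point[OF G z(1,2)] z(3) Gz by simp
  have "b \<noteq> 0"
  \<comment> \<open>With \<open>b = 0\<close> the whole sphere would consist of zeros, including the
    point with \<open>- J\<close>, which differs from \<open>q\<close>.\<close>
  proof
    assume "b = 0"
    then have "G z = 0" using eq Gz by (simp add: alt_zero_right zero_prod_def)
    then have "\<forall>x\<in>sphere_of q. g x = 0"
      using zero_on_sphere_iff[OF D G g z(1,2)] z(3) by simp
    moreover have "slice_point z (- J) \<in> sphere_of q"
      unfolding z(3) sphere_of_def mem_Collect_eq
      by (intro exI[of _ z] exI[of _ "- J"]) (use z(2) in \<open>auto simp: imag_units_minus\<close>)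
    ultimately have "slice_point z (- J) = q" using qs(3) by blast
    then have "Im z *\<^sub>R J = 0"
      unfolding z(3) slice_point_def using eq_uminus_imp_zero[of "Im z *\<^sub>R J"] by simp
    then have "Im z = 0 \<or> J = 0" by simp
    moreover have "J \<noteq> 0" using imag_unitD(2)[OF z(2)] by auto
    ultimately show False using qs(2) z by (simp add: nonreal_slice_point_iff)
  qed
  have "(J * b) * cjg b = (norm b)\<^sup>2 *\<^sub>R J"
  proof -
    \<comment> \<open>\<open>cjg b\<close> is a real combination of \<open>1\<close> and
      \<open>b\<close>, so right alternativity replaces associativity.\<close>
    have "(J * b) * cjg b = J * (b * cjg b)"
      by (simp add: cjg_eq alt_bilinear alt_right)
    then show ?thesis by (simp add: cjg_norm alt_bilinear)
  qed
  moreover have "J * b = - a" using eq by (simp add: eq_neg_iff_add_eq_0 add.commute)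
  ultimately have "(norm b)\<^sup>2 *\<^sub>R J = - (a * cjg b)" by (simp add: alt_bilinear)
  then have J: "J = (- inverse ((norm b)\<^sup>2)) *\<^sub>R (a * cjg b)"
    using \<open>b \<noteq> 0\<close> by (metis (no_types, lifting) left_inverse norm_eq_zero power_not_zero scaleR_minus_left
        scaleR_minus_right scaleR_one scaleR_scaleR)
  obtain r s r' s' where ab: "a = r *\<^sub>R 1 + s *\<^sub>R I" "b = r' *\<^sub>R 1 + s' *\<^sub>R I"
    using GI[OF z(1)] Gz slice by auto
  have "a * cjg b = (r * r' + s * s') *\<^sub>R 1 + (s * r' - r * s') *\<^sub>R I"
    unfolding ab using I imag_unitD(3)[OF I]
    by (simp add: cjg_add cjg_scaleR cjg_one alt_bilinear imag_units_def scaleR_left_distrib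
        scaleR_left_diff_distrib scaleR_right_distrib algebra_simps)
  then have "a * cjg b \<in> slice I" unfolding slice by blast
  then have "J \<in> slice I" unfolding J slice_def by (rule span_scale)
  moreover have "1 \<in> slice I" by (simp add: slice_def span_base)
  ultimately show ?thesis
    unfolding z(3) slice_point_def slice_def by (intro span_add span_scale)
qed

text \<open>Since \<open>1\<close> and \<open>J\<close> are orthonormal, inner products with them
  recover \<open>z\<close> from \<open>slice_point z J\<close>. This gives a homeomorphism that
  carries simple connectedness from the half slice to the upper half of \<open>D\<close>.\<close>

lemma basic_domainD:
  fixes \<Omega> :: "'a::alt_star_algebra set"
  assumes "basic_domain D \<Omega>"
  shows "open D" "cnj ` D = D" "\<Omega> = circularization D" "simply_connected (D \<inter> {z. Im z > 0})"
proof -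
  show D: "open D" "cnj ` D = D" "\<Omega> = circularization D"
    using assms by (auto simp: basic_domain_def circular_domain_def)
  obtain J :: 'a where J: "J \<in> imag_units" using imag_units_nonempty by blast
  have eq: "\<Omega> \<inter> upper_half_slice J = (\<lambda>z. slice_point z J) ` (D \<inter> {z. Im z > 0})"
  proof (rule Set.equalityI)
    show "\<Omega> \<inter> upper_half_slice J \<subseteq> (\<lambda>z. slice_point z J) ` (D \<inter> {z. Im z > 0})"
    proof
      fix x assume x: "x \<in> \<Omega> \<inter> upper_half_slice J"
      then obtain z where z: "x = slice_point z J" "Im z > 0" by (auto simp: upper_half_slice_def)
      obtain w I where w: "w \<in> D" "I \<in> imag_units" "x = slice_point w I"
        using x D(3) by (auto elim: circularizationE)
      have "z = w \<or> z = cnj w" using slice_point_eq[OF w(2) J, of w z] z(1) w(3) by auto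
      then have "z \<in> D" using w(1) D(2) by (auto simp: cnj_mem_iff)
      with z show "x \<in> (\<lambda>z. slice_point z J) ` (D \<inter> {z. Im z > 0})" by blast
    qed
    show "(\<lambda>z. slice_point z J) ` (D \<inter> {z. Im z > 0}) \<subseteq> \<Omega> \<inter> upper_half_slice J"
      using J D(3) by (auto simp: upper_half_slice_def slice_point_in_circularization)
  qed
  have inv: "inner 1 (slice_point z J) = Re z" "inner J (slice_point z J) = Im z" for z
    using imag_unitD[OF J] norm_eq_1[of J]
    by (simp_all add: slice_point_def inner_add_right inner_one_one inner_commute)
  have "(\<lambda>z. slice_point z J) ` (D \<inter> {z. Im z > 0}) homeomorphic (D \<inter> {z. Im z > 0})"
    unfolding homeomorphic_minimal
  proof (intro exI conjI ballI)
    let ?f = "\<lambda>x. Complex (inner 1 x) (inner J x)"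
    show "continuous_on ((\<lambda>z. slice_point z J) ` (D \<inter> {z. Im z > 0})) ?f"
      unfolding Complex_eq by (intro continuous_intros)
    show "continuous_on (D \<inter> {z. Im z > 0}) (\<lambda>z. slice_point z J)"
      unfolding slice_point_def by (intro continuous_intros)
  qed (auto simp: inv)
  moreover have "simply_connected (\<Omega> \<inter> upper_half_slice J)"
    using assms J by (auto simp: basic_domain_def)
  ultimately show "simply_connected (D \<inter> {z. Im z > 0})"
    unfolding eq by (simp add: homeomorphic_simply_connected_eq)
qed

theorem ex_semi_model:
  fixes \<Omega> :: "'a::alt_star_algebra set"
  assumes dom: "basic_domain D \<Omega>" and f: "slice_regular D f"
    and nz: "\<exists>x\<in>\<Omega>. normal_fun D f x \<noteq> 0"
  shows "\<exists>g. semi_model D f g"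
proof -
  note D = basic_domainD(1,2)[OF dom] and \<Omega> = basic_domainD(3)[OF dom] and sc = basic_domainD(4)[OF dom]
  obtain F where F: "stem_function D F" "stem_holomorphic D F"
    and fF: "\<forall>x\<in>circularization D. f x = slice_fun D F x"
    using f by (auto simp: slice_regular_def)
  define h where "h z = complexified_norm (F z)" for z
  have h_hol: "h holomorphic_on D" using complexified_norm_holomorphic[OF D(1) F(2)] by (simp add: h_def[abs_def])
  have h_real: "h (cnj z) = cnj (h z)" if "z \<in> D" for z
    using complexified_norm_stem[OF F(1) that] by (simp add: h_def)
  have h_nonneg: "Re (h x) \<ge> 0" if x: "x \<in> D" "Im x = 0" for x
  proof -
    have "cnj x = x" using x(2) by (simp add: complex_eq_iff)
    \<comment> \<open>At a real point the second part of the stem vanishes, so \<open>h\<close> is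
      the squared norm of the first.\<close>
    then have "cx_bar (F x) = F x" using F(1) x(1) by (metis stem_function_def)
    then have "- snd (F x) = snd (F x)" by (simp add: cx_bar_def case_prod_unfold prod_eq_iff)
    then have "snd (F x) = 0" using eq_uminus_imp_zero by metis
    then show ?thesis by (simp add: h_def complexified_norm_def case_prod_unfold)
  qed
  have "\<exists>\<zeta>\<in>D. h \<zeta> \<noteq> 0"
  proof (rule ccontr)
    assume "\<not> ?thesis"
    then have h0: "h z = 0" if "z \<in> D" for z using that by blast
    have "normal_fun D f x = 0" if "x \<in> \<Omega>" for x
    proof -
      have "normal_fun D f = slice_fun D (\<lambda>z. (Re (h z) *\<^sub>R 1, Im (h z) *\<^sub>R 1))"
        unfolding normal_fun_eq[OF D(2) F(1) fF] h_def ..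
      moreover obtain z I where "z \<in> D" "I \<in> imag_units" "x = slice_point z I"
        using \<open>x \<in> \<Omega>\<close> unfolding \<Omega> by (rule circularizationE)
      ultimately show ?thesis
        using slice_fun_slice_point[OF stem_function_complex[of D h, OF h_real], of z I] h0[of z]
        by (simp add: alt_zero_right)
    qed
    with nz show False by blast
  qed
  then obtain \<zeta> where \<zeta>: "\<zeta> \<in> D" "h \<zeta> \<noteq> 0" by blast
  have ev: "\<forall>\<^sub>F w in at z. h w \<noteq> 0" if "z \<in> D" for z
    using eventually_nonzero_of_reflection_symmetric[OF D simply_connected_imp_connected[OF sc] h_hol h_real \<zeta> that]
    by blast
  define P where "P z m n \<longleftrightarrow> has_order D z n h \<and> (\<forall>k. (\<forall>v\<in>Basis. power_dvd D z k (component F v)) \<longleftrightarrow> k \<le> m) \<and>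
      2 * m \<le> n \<and> (Im z = 0 \<longrightarrow> n = 2 * m)" for z m n
  have "\<exists>m n. P z m n" if "z \<in> D" for z
    using stem_common_order[OF D F ev[OF that, unfolded h_def] that] unfolding P_def h_def[abs_def] by metis
  then obtain m n where "\<And>z. z \<in> D \<Longrightarrow> P z (m z) (n z)" by metis
  then have n: "\<And>z. z \<in> D \<Longrightarrow> has_order D z (n z) h"
    and m: "\<And>z k. z \<in> D \<Longrightarrow> (\<forall>v\<in>Basis. power_dvd D z k (component F v)) \<longleftrightarrow> k \<le> m z"
    and mn: "\<And>z. z \<in> D \<Longrightarrow> 2 * m z \<le> n z" "\<And>z. z \<in> D \<Longrightarrow> Im z = 0 \<Longrightarrow> n z = 2 * m z"
    unfolding P_def by blast+
  \<comment> \<open>Reflection moves a common power of the coordinates from \<open>cnj z\<close> to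
    \<open>z\<close>; using this at both points gives equality.\<close>
  have m_le: "m (cnj z) \<le> m z" if z: "z \<in> D" for z
  proof -
    have "power_dvd D z (m (cnj z)) (component F v)" if v: "v \<in> Basis" for v
    proof -
      have "power_dvd D (cnj z) (m (cnj z)) (component F v)"
        using m[of "cnj z" "m (cnj z)"] v z D(2) by (simp add: cnj_mem_iff)
      then have "power_dvd D z (m (cnj z)) (reflect (component F v))"
        using power_dvd_reflect[OF D, of "cnj z"] by simp
      moreover have "reflect (component F v) w = component F v w" if "w \<in> D" for w
        using F(1) v that unfolding stem_function_iff reflect_def by simp
      ultimately show ?thesis using power_dvd_cong by blast
    qed
    then show ?thesis using m[OF z] by blast
  qed
  have m_cnj: "m (cnj z) = m z" if z: "z \<in> D" for z
    using m_le[OF z] m_le[of "cnj z"] z D(2) by (simp add: cnj_mem_iff)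
  have n_cnj: "n (cnj z) = n z" if z: "z \<in> D" for z
  proof -
    have "has_order D (cnj z) (n z) (reflect h)" using has_order_reflect[OF D n[OF z]] .
    moreover have "reflect h w = h w" if "w \<in> D" for w
      using h_real[OF that] by (simp add: reflect_def)
    ultimately have "has_order D (cnj z) (n z) h" using has_order_cong by blast
    then show ?thesis
      using has_order_unique[OF D(1) _ n] z D(2) by (simp add: cnj_mem_iff)
  qed
  \<comment> \<open>On the real axis \<open>n z = 2 * m z\<close>, so both branches would give
    \<open>m z\<close> there.\<close>
  define c where "c z = (if Im z \<ge> 0 then n z - m z else m z)" for z
  have "c z + c (cnj z) = n z" if z: "z \<in> D" for z
    using mn[OF z] m_cnj[OF z] n_cnj[OF z] by (auto simp: c_def)
  then have ord: "has_order D z (c z + c (cnj z)) h" if "z \<in> D" for z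
    using n that by simp
  obtain \<phi> where \<phi>: "\<phi> holomorphic_on D" "\<And>z. z \<in> D \<Longrightarrow> has_order D z (c z) \<phi>"
    "\<And>z. z \<in> D \<Longrightarrow> \<phi> z * reflect \<phi> z = h z"
    using reflection_factorization[OF D sc ord h_real h_nonneg] by blast
  obtain I :: 'a where I: "I \<in> imag_units" using imag_units_nonempty by blast
  note II = imag_unitD[OF I]
  define G\<^sub>0 where "G\<^sub>0 z = (\<phi> z + reflect \<phi> z) / 2" for z
  define G\<^sub>1 where "G\<^sub>1 z = (\<phi> z - reflect \<phi> z) / (2 * \<i>)" for z
  define G :: "complex \<Rightarrow> 'a complexified" where
    "G z = (Re (G\<^sub>0 z) *\<^sub>R 1 + Re (G\<^sub>1 z) *\<^sub>R I, Im (G\<^sub>0 z) *\<^sub>R 1 + Im (G\<^sub>1 z) *\<^sub>R I)" for z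
  have reflect_hol: "reflect \<phi> holomorphic_on D" using holomorphic_on_reflect[OF D(1)] \<phi>(1) D(2) by simp
  have comp_G: "component G v = (\<lambda>z. of_real (inner 1 v) * G\<^sub>0 z + of_real (inner I v) * G\<^sub>1 z)" for v
    by (simp add: fun_eq_iff component_def G_def inner_add_left complex_eq_iff)
  have G_real: "G\<^sub>0 (cnj z) = cnj (G\<^sub>0 z)" "G\<^sub>1 (cnj z) = cnj (G\<^sub>1 z)" for z
    by (simp_all add: G\<^sub>0_def G\<^sub>1_def reflect_def field_simps)
  have G: "stem_function D G" "stem_holomorphic D G"
  proof -
    show "stem_function D G" unfolding stem_function_iff comp_G by (simp add: G_real)
    have "G\<^sub>0 holomorphic_on D" "G\<^sub>1 holomorphic_on D"
      unfolding G\<^sub>0_def[abs_def] G\<^sub>1_def[abs_def] by (intro holomorphic_intros \<phi>(1) reflect_hol; simp)+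
    then show "stem_holomorphic D G"
      unfolding stem_holomorphic_iff[OF D(1)] comp_G by (intro ballI holomorphic_intros)
  qed
  have norm_G: "complexified_norm (G z) = h z" if "z \<in> D" for z
  proof -
    have "inner (r *\<^sub>R 1 + s *\<^sub>R I) (r' *\<^sub>R 1 + s' *\<^sub>R I) = r * r' + s * s'" for r s r' s'
      using II norm_eq_1[of I]
      by (simp add: inner_add_left inner_add_right inner_one_one inner_commute[of I 1])
    then have "complexified_norm (G z) = (G\<^sub>0 z)\<^sup>2 + (G\<^sub>1 z)\<^sup>2"
      unfolding complexified_norm_def G_def prod.case power2_norm_eq_inner
      by (simp add: complex_eq_iff power2_eq_square)
    also have "\<dots> = \<phi> z * reflect \<phi> z"
      by (simp add: G\<^sub>0_def G\<^sub>1_def power2_eq_square field_simps)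
    finally show ?thesis using \<phi>(3)[OF that] by simp
  qed
  \<comment> \<open>\<open>G\<^sub>0\<close>, \<open>G\<^sub>1\<close> and \<open>\<phi>\<close>,
    \<open>reflect \<phi>\<close> are constant linear combinations of each other, so the two pairs
    have the same common powers.\<close>
  have dvd_G: "(\<forall>v\<in>Basis. power_dvd D z k (component G v)) \<longleftrightarrow> power_dvd D z k \<phi> \<and> power_dvd D z k (reflect \<phi>)" for z k
  proof
    assume *: "\<forall>v\<in>Basis. power_dvd D z k (component G v)"
    have "component G 1 = G\<^sub>0" "component G I = G\<^sub>1"
      using II norm_eq_1[of I] by (simp_all add: comp_G inner_one_one inner_commute fun_eq_iff)
    then have 01: "power_dvd D z k G\<^sub>0" "power_dvd D z k G\<^sub>1"
      using power_dvd_component[OF *] by metis+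
    have "\<phi> = (\<lambda>w. G\<^sub>0 w + \<i> * G\<^sub>1 w)" "reflect \<phi> = (\<lambda>w. G\<^sub>0 w + (-\<i>) * G\<^sub>1 w)"
      by (simp_all add: G\<^sub>0_def G\<^sub>1_def fun_eq_iff field_simps)
    then show "power_dvd D z k \<phi> \<and> power_dvd D z k (reflect \<phi>)"
      using power_dvd_add[OF 01(1) power_dvd_cmult[OF 01(2)]] by metis
  next
    assume *: "power_dvd D z k \<phi> \<and> power_dvd D z k (reflect \<phi>)"
    have "G\<^sub>0 = (\<lambda>w. (1/2) * \<phi> w + (1/2) * reflect \<phi> w)" "G\<^sub>1 = (\<lambda>w. (-\<i>/2) * \<phi> w + (\<i>/2) * reflect \<phi> w)"
      by (simp_all add: G\<^sub>0_def G\<^sub>1_def fun_eq_iff field_simps)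
    then have "power_dvd D z k G\<^sub>0" "power_dvd D z k G\<^sub>1"
      using * power_dvd_add power_dvd_cmult by metis+
    then show "\<forall>v\<in>Basis. power_dvd D z k (component G v)"
      unfolding comp_G by (intro ballI power_dvd_add power_dvd_cmult)
  qed
  have dvd: "(\<forall>v\<in>Basis. power_dvd D z k (component F v)) \<longleftrightarrow> (\<forall>v\<in>Basis. power_dvd D z k (component G v))"
    if z: "z \<in> D" "Im z \<noteq> 0" for z k
  proof -
    have "has_order D z (c (cnj z)) (reflect \<phi>)"
      using has_order_reflect[OF D \<phi>(2)[of "cnj z"]] z D(2) by (simp add: cnj_mem_iff)
    then have "(\<forall>v\<in>Basis. power_dvd D z k (component G v)) \<longleftrightarrow> k \<le> c z \<and> k \<le> c (cnj z)"
      unfolding dvd_G using power_dvd_iff_le_order[OF D(1) z(1)] \<phi>(2)[OF z(1)] by blast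
    \<comment> \<open>At \<open>z\<close> and \<open>cnj z\<close> the values of \<open>c\<close>
      are \<open>n z - m z\<close> and \<open>m z\<close> in some order; the smaller is
      \<open>m z\<close> because \<open>2 * m z \<le> n z\<close>.\<close>
    also have "\<dots> \<longleftrightarrow> k \<le> m z"
      using mn(1)[OF z(1)] m_cnj[OF z(1)] n_cnj[OF z(1)] z(2) by (auto simp: c_def)
    finally show ?thesis using m[OF z(1)] by simp
  qed
  let ?g = "slice_fun D G"
  have gG: "\<forall>x\<in>circularization D. ?g x = slice_fun D G x" by simp
  have "semi_model D f ?g"
    unfolding semi_model_def
  proof (intro conjI ballI allI impI bexI[OF _ I])
    show "slice_regular D ?g" using G by (auto simp: slice_regular_def)
    have "normal_fun D ?g = normal_fun D f"
      unfolding normal_fun_eq[OF D(2) F(1) fF] normal_fun_eq[OF D(2) G(1) gG]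
      by (intro slice_fun_cong) (simp add: norm_G h_def)
    then show "normal_fun D ?g x = normal_fun D f x" for x by simp
    show "spherical_zeros D ?g = spherical_zeros D f"
      by (rule spherical_data_cong(1)[OF D F G fF gG dvd])
    show "spherical_multiplicity D ?g q = spherical_multiplicity D f q" if "sphere_of q \<in> spherical_zeros D f" for q
      by (rule spherical_data_cong(2)[OF D F G fF gG dvd that])
    have "r *\<^sub>R 1 + s *\<^sub>R I \<in> slice I" for r s
      unfolding slice_def by (intro span_add span_scale span_base) auto
    then have "fst (G z) \<in> slice I \<and> snd (G z) \<in> slice I" for z
      by (simp add: G_def)
    then show "q \<in> slice I" if "isolated_nonreal_zero D ?g q" for q
      by (intro isolated_zero_in_slice[OF D(2) G(1) gG I _ that])
  qed
  then show ?thesis by blast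
qed

theorem theorem4p20:
  shows "(\<forall>D (\<Omega> :: quaternion set) f.
            basic_domain D \<Omega> \<and> slice_regular D f \<and> (\<exists>x\<in>\<Omega>. normal_fun D f x \<noteq> 0) \<longrightarrow>
            (\<exists>g. semi_model D f g)) \<and>
         (\<forall>D (\<Omega> :: octonion set) f.
            basic_domain D \<Omega> \<and> slice_regular D f \<and> (\<exists>x\<in>\<Omega>. normal_fun D f x \<noteq> 0) \<longrightarrow>
            (\<exists>g. semi_model D f g))"
  by (intro conjI allI impI; elim conjE; rule ex_semi_model)

end
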